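(* Let $n,k$ be positive integers, let $\mathcal G\subset[n]^k$, and set $\alpha=|\mathcal G|/n^k$. Let $\mathcal M=(M_1,\ldots,M_n)$ be an ordered perfect matching of $[n]^k$ chosen uniformly at random among all ordered perfect matchings, and let $\eta=|\mathcal G\cap\{M_1,\ldots,M_n\}|$ (so $\mathsf E\eta=\alpha n$). Then for any $\lambda>0$ and $\delta\in\{-1,1\}$, $$\mathsf P[\delta\cdot(\eta-\alpha n)\ge 2\lambda]\le 2\exp\Big(-\frac{\lambda^2}{\alpha n/2+2\lambda}\Big).$$ Moreover, for any $\mu>0$, any $\lambda$ with $\lambda\ge 2\sqrt{\alpha n}+1\ge 9$, and any $\delta\in\{-1,1\}$, $$\mathsf P\big[\delta\cdot(\eta-\alpha n)>2\lambda+2\mu\big]\le \mathsf P\big[\delta\cdot(\eta-\alpha n)\ge 1\big]\cdot 4\exp\Big(-\frac{\mu^2}{(\alpha n+2\lambda)/2+2\mu}\Big).$$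
   Context: $[n]=\{1,\ldots,n\}$ and $[n]^k$ is the set of $k$-tuples with entries in $[n]$. Two tuples $(f_1,\ldots,f_k),(f'_1,\ldots,f'_k)$ are disjoint if $f_i\neq f'_i$ for all $i$. A perfect matching of $[n]^k$ is a set of $n$ pairwise disjoint tuples of $[n]^k$ (equivalently, for each coordinate $i$, the $i$-th entries of the $n$ tuples are exactly $1,\ldots,n$); an ordered perfect matching is a perfect matching listed as a sequence $(M_1,\ldots,M_n)$. *)

theory Defs
  imports "HOL-Probability.Probability"
begin

definition tuples :: "nat \<Rightarrow> nat \<Rightarrow> (nat \<Rightarrow> nat) set" where
  "tuples n k = {1..k} \<rightarrow>\<^sub>E {1..n}"

definition disjoint_tuples :: "nat \<Rightarrow> (nat \<Rightarrow> nat) \<Rightarrow> (nat \<Rightarrow> nat) \<Rightarrow> bool" where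
  "disjoint_tuples k f g \<longleftrightarrow> (\<forall>i\<in>{1..k}. f i \<noteq> g i)"

definition perfect_matching :: "nat \<Rightarrow> nat \<Rightarrow> (nat \<Rightarrow> nat) set \<Rightarrow> bool" where
  "perfect_matching n k P \<longleftrightarrow>
     P \<subseteq> tuples n k \<and> card P = n \<and> pairwise (disjoint_tuples k) P"

text \<open>A duplicate-free list of the members of a perfect matching; \<open>distinct\<close> makes its
  length equal to \<open>n\<close>, and \<open>M ! i\<close> is the \<open>(i + 1)\<close>-st tuple.\<close>

definition ordered_perfect_matchings :: "nat \<Rightarrow> nat \<Rightarrow> (nat \<Rightarrow> nat) list set" where
  "ordered_perfect_matchings n k = {M. distinct M \<and> perfect_matching n k (set M)}"

text \<open>\<open>pmf_of_set\<close> is the uniform distribution only on finite nonempty sets; the two lemmas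
  below discharge this for \<open>k > 0\<close>.\<close>

definition random_ordered_perfect_matching :: "nat \<Rightarrow> nat \<Rightarrow> (nat \<Rightarrow> nat) list pmf" where
  "random_ordered_perfect_matching n k = pmf_of_set (ordered_perfect_matchings n k)"

lemma finite_ordered_perfect_matchings: "finite (ordered_perfect_matchings n k)"
proof (rule finite_subset)
  show "ordered_perfect_matchings n k \<subseteq> {M. set M \<subseteq> tuples n k \<and> length M = n}"
    by (auto simp: ordered_perfect_matchings_def perfect_matching_def distinct_card)
  show "finite {M. set M \<subseteq> tuples n k \<and> length M = n}"
    by (rule finite_lists_length_eq) (simp add: tuples_def finite_PiE)
qed

lemma ordered_perfect_matchings_nonempty:
  assumes "k > 0"
  shows "ordered_perfect_matchings n k \<noteq> {}"
proof -
  define c :: "nat \<Rightarrow> nat \<Rightarrow> nat" where "c = (\<lambda>j. \<lambda>i\<in>{1..k}. j)"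
  have c: "c j i = j" if "i \<in> {1..k}" for i j
    using that by (simp add: c_def)
  have inj: "inj_on c {1..n}"
  proof (rule inj_onI)
    fix a b assume "c a = c b"
    then have "c a 1 = c b 1" by simp
    then show "a = b" using c assms by simp
  qed
  have "perfect_matching n k (c ` {1..n})"
    unfolding perfect_matching_def pairwise_def disjoint_tuples_def tuples_def
    using card_image[OF inj] c by (auto simp: c_def)
  then have "map c [1..<Suc n] \<in> ordered_perfect_matchings n k"
    using inj by (simp add: ordered_perfect_matchings_def distinct_map atLeastLessThanSuc_atLeastAtMost
        del: upt_Suc)
  then show ?thesis by blast
qed

definition hits :: "(nat \<Rightarrow> nat) set \<Rightarrow> (nat \<Rightarrow> nat) list \<Rightarrow> real" where
  "hits G M = real (card (G \<inter> set M))"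

end

theory Submission
  imports Defs
begin

text \<open>
  Draw the matching one coordinate at a time, each coordinate being a uniform bijection from the \<open>n\<close>
  rows to \<open>{1..n}\<close>. Conditionally on the coordinates already drawn, row \<open>j\<close> becomes a hit with
  probability \<open>p j\<close>, and one more coordinate replaces \<open>p j\<close> by \<open>A j (\<sigma> j)\<close>, where row \<open>j\<close> of \<open>A\<close> has
  mean \<open>p j\<close>. For independent rows the product of \<open>1 + (exp s - 1) * p j\<close> would be a martingale whose
  final value is \<open>exp s\<close> to the number of hits. A bijection makes the rows dependent, which costs a
  factor controlled by the row variances (\<open>permanent_bound\<close>); replacing the linear factor by a slightly
  concave quadratic one absorbs it, since concavity gains a multiple of the same variances. So the
  number of hits has essentially the exponential moments of a binomial variable.

  For the second estimate the bijections are revealed entry by entry. The conditional mean then moves by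
  at most 2 per step, hence it must visit the window from \<open>lam\<close> to \<open>lam + 2\<close> beyond \<open>\<alpha> n\<close>
  before the final value can get far. From there a further deviation is exponentially
  unlikely, while falling back to within 1 of \<open>\<alpha> n\<close> has probability at most 3/4.
\<close>

section \<open>Averages and random bijections\<close>

text \<open>Rows of a random bijection are not negatively dependent. For two rows with means
  \<open>u\<close>, \<open>w\<close> and half differences \<open>x\<close>, \<open>y\<close> the
  mean product is \<open>u * w - x * y\<close>, which exceeds \<open>u * w\<close> when the rows
  favour different values; a comparison with independent rows must therefore lose something. What
  makes the loss bearable is its size: a cost of order \<open>1 / sqrt r\<close> per unit of row
  variance, with variances that sum to at most both the mean \<open>X\<close> and
  \<open>r / 4\<close>, adds only a multiple of \<open>s^2 * sqrt X\<close> to an exponent whose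
  main term is \<open>s^2 * X / 2\<close>. In the first estimate this correction is traded against
  the cubic term and a constant, and \<open>exp (2/3) \<le> 2\<close> becomes the factor 2. In the
  second it is absorbed by the second \<open>lam\<close> in \<open>2 * lam + 2 * mu\<close>, and the
  factor 4 is the inverse of the probability 1/4 of not falling back. The main Chernoff parameter
  has the form \<open>t / (M + 4 * t)\<close>, so \<open>\<bar>s\<bar> \<le> 1/4\<close> throughout;
  this confines the normalised factors to the interval from 1 to 9/7.\<close>

definition avg :: "'a set \<Rightarrow> ('a \<Rightarrow> real) \<Rightarrow> real" where
  "avg S f = (\<Sum>x\<in>S. f x) / real (card S)"

definition var :: "'a set \<Rightarrow> ('a \<Rightarrow> real) \<Rightarrow> real" where
  "var S f = avg S (\<lambda>x. (f x - avg S f)\<^sup>2)"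

lemma avg_mono: "(\<And>x. x \<in> S \<Longrightarrow> f x \<le> g x) \<Longrightarrow> avg S f \<le> avg S g"
  unfolding avg_def by (intro divide_right_mono sum_mono) auto

lemma avg_cong: "S = T \<Longrightarrow> (\<And>x. x \<in> T \<Longrightarrow> f x = g x) \<Longrightarrow> avg S f = avg T g"
  unfolding avg_def by (simp cong: sum.cong)

lemma avg_const: "finite S \<Longrightarrow> S \<noteq> {} \<Longrightarrow> avg S (\<lambda>_. c) = c"
  unfolding avg_def by simp

lemma avg_add: "avg S (\<lambda>x. f x + g x) = avg S f + avg S g"
  unfolding avg_def by (simp add: sum.distrib add_divide_distrib)

lemma avg_diff: "avg S (\<lambda>x. f x - g x) = avg S f - avg S g"
  unfolding avg_def by (simp add: sum_subtractf diff_divide_distrib)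

lemma avg_cmult: "avg S (\<lambda>x. c * f x) = c * avg S f"
  unfolding avg_def by (simp add: sum_distrib_left)

lemma avg_sum: "avg S (\<lambda>x. \<Sum>i\<in>I. f i x) = (\<Sum>i\<in>I. avg S (f i))"
  unfolding avg_def by (subst sum.swap) (simp add: sum_divide_distrib)

lemma avg_swap: "avg S (\<lambda>x. avg T (f x)) = avg T (\<lambda>y. avg S (\<lambda>x. f x y))"
  unfolding avg_def by (simp add: sum_divide_distrib[symmetric]) (metis (no_types) mult.commute sum.swap)

lemma avg_nonneg: "(\<And>x. x \<in> S \<Longrightarrow> 0 \<le> f x) \<Longrightarrow> 0 \<le> avg S f"
  unfolding avg_def by (simp add: sum_nonneg)

lemma avg_le: "finite S \<Longrightarrow> S \<noteq> {} \<Longrightarrow> (\<And>x. x \<in> S \<Longrightarrow> f x \<le> c) \<Longrightarrow> avg S f \<le> c"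
  using avg_mono[of S f "\<lambda>_. c"] avg_const[of S c] by simp

lemma avg_ge: "finite S \<Longrightarrow> S \<noteq> {} \<Longrightarrow> (\<And>x. x \<in> S \<Longrightarrow> c \<le> f x) \<Longrightarrow> c \<le> avg S f"
  using avg_mono[of S "\<lambda>_. c" f] avg_const[of S c] by simp

lemma var_nonneg: "0 \<le> var S f"
  unfolding var_def by (rule avg_nonneg) simp

lemma avg_square_diff:
  assumes "finite S" "S \<noteq> {}"
  shows "avg S (\<lambda>x. (f x - c)\<^sup>2) = var S f + (avg S f - c)\<^sup>2"
proof -
  define m where "m = avg S f"
  have "avg S (\<lambda>x. (f x - c)\<^sup>2)
      = avg S (\<lambda>x. (f x - m)\<^sup>2 + (2 * (m - c) * (f x - m) + (m - c)\<^sup>2))"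
    by (rule avg_cong) (auto simp: power2_eq_square algebra_simps)
  also have "\<dots> = var S f + (2 * (m - c) * (avg S f - m) + (m - c)\<^sup>2)"
    using assms by (simp only: avg_add avg_cmult avg_diff avg_const[OF assms] var_def m_def)
  finally show ?thesis by (simp add: m_def)
qed

lemma avg_square:
  assumes "finite S" "S \<noteq> {}"
  shows "avg S (\<lambda>x. (f x)\<^sup>2) = var S f + (avg S f)\<^sup>2"
  using avg_square_diff[OF assms, of f 0] by simp

lemma var_le_avg_square_diff:
  assumes "finite S" "S \<noteq> {}"
  shows "var S f \<le> avg S (\<lambda>x. (f x - c)\<^sup>2)"
  using avg_square_diff[OF assms, of f c] by simp

lemma var_le_of_range:
  assumes "finite S" "S \<noteq> {}" "\<And>x. x \<in> S \<Longrightarrow> l \<le> f x" "\<And>x. x \<in> S \<Longrightarrow> f x \<le> u"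
  shows "var S f \<le> ((u - l) / 2)\<^sup>2"
proof -
  have "var S f \<le> avg S (\<lambda>x. (f x - (l + u) / 2)\<^sup>2)"
    by (rule var_le_avg_square_diff[OF assms(1,2)])
  also have "\<dots> \<le> ((u - l) / 2)\<^sup>2"
  proof (rule avg_le[OF assms(1,2)])
    fix x assume "x \<in> S"
    then have "\<bar>f x - (l + u) / 2\<bar> \<le> (u - l) / 2"
      using assms(3,4)[of x] by (auto simp: abs_le_iff field_simps)
    then show "(f x - (l + u) / 2)\<^sup>2 \<le> ((u - l) / 2)\<^sup>2"
      by (metis abs_le_square_iff abs_of_nonneg abs_ge_zero order_trans)
  qed
  finally show ?thesis .
qed

lemma var_le_mean:
  assumes "finite S" "S \<noteq> {}" "\<And>x. x \<in> S \<Longrightarrow> 0 \<le> f x" "\<And>x. x \<in> S \<Longrightarrow> f x \<le> 1"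
  shows "var S f \<le> avg S f * (1 - avg S f)"
proof -
  have "avg S (\<lambda>x. (f x)\<^sup>2) \<le> avg S f"
    by (rule avg_mono) (use assms in \<open>auto simp: power2_eq_square mult_left_le\<close>)
  then show ?thesis
    using avg_square[OF assms(1,2), of f] by (simp add: power2_eq_square algebra_simps)
qed

text \<open>\<open>h (avg S f)\<close> is in general not the mean of \<open>h (f x)\<close>, but the
  variance is the least mean square about any constant, so it may serve as the centre.\<close>

lemma var_lipschitz:
  assumes "finite S" "S \<noteq> {}" "\<And>x. x \<in> S \<Longrightarrow> \<bar>h (f x) - h (avg S f)\<bar> \<le> K * \<bar>f x - avg S f\<bar>"
  shows "var S (\<lambda>x. h (f x)) \<le> K\<^sup>2 * var S f"
proof -
  have "var S (\<lambda>x. h (f x)) \<le> avg S (\<lambda>x. (h (f x) - h (avg S f))\<^sup>2)"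
    by (rule var_le_avg_square_diff[OF assms(1,2)])
  also have "\<dots> \<le> avg S (\<lambda>x. K\<^sup>2 * (f x - avg S f)\<^sup>2)"
  proof (rule avg_mono)
    fix x assume "x \<in> S"
    from assms(3)[OF this] have "\<bar>h (f x) - h (avg S f)\<bar>\<^sup>2 \<le> (K * \<bar>f x - avg S f\<bar>)\<^sup>2"
      by (rule power_mono) simp
    then show "(h (f x) - h (avg S f))\<^sup>2 \<le> K\<^sup>2 * (f x - avg S f)\<^sup>2"
      by (simp add: power_mult_distrib)
  qed
  finally show ?thesis by (simp add: avg_cmult var_def)
qed

lemma avg_remove:
  assumes "finite S" "a \<in> S" "card S \<ge> 2"
  shows "avg (S - {a}) f = avg S f - (f a - avg S f) / (real (card S) - 1)"
proof -
  have "(\<Sum>x\<in>S. f x) = f a + (\<Sum>x\<in>S - {a}. f x)"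
    using assms by (simp add: sum.remove)
  moreover have "real (card (S - {a})) = real (card S) - 1"
    using assms by (simp add: of_nat_diff)
  moreover have "(y + T) / n - (y - (y + T) / n) / (n - 1) = T / (n - 1) + ((n - 1) * y - (n - 1) * y) / (n * (n - 1))"
    if "n \<noteq> 0" "n - 1 \<noteq> 0" for y T n :: real
    using that by (simp add: divide_simps) (simp add: algebra_simps)
  moreover have "real (card S) \<noteq> 0" "real (card S) - 1 \<noteq> 0" using assms by auto
  ultimately show ?thesis by (simp add: avg_def)
qed

lemma var_remove:
  assumes "finite S" "a \<in> S" "card S \<ge> 2"
  defines "e \<equiv> 1 / (real (card S) - 1)"
  shows "var (S - {a}) f = (1 + e) * (var S f - e * (f a - avg S f)\<^sup>2)"
proof -
  have ne: "finite (S - {a})" "S - {a} \<noteq> {}" "finite S" "S \<noteq> {}"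
    using assms card_mono[of "{a}" S] by auto
  have e: "e * (real (card S) - 1) = 1" using assms by (simp add: e_def)
  define m where "m = avg S f"
  define D where "D = (f a - m)\<^sup>2"
  \<comment> \<open>The mean square about the old mean is itself an average, so
    \<open>avg_remove\<close> applies; recentring at the new mean then subtracts the square of the
    shift.\<close>
  have 1: "avg (S - {a}) (\<lambda>x. (f x - m)\<^sup>2) = var S f - e * (D - var S f)"
    using avg_remove[OF assms(1-3), of "\<lambda>x. (f x - m)\<^sup>2"] by (simp add: var_def m_def D_def e_def)
  have 2: "avg (S - {a}) f - m = - e * (f a - m)"
    using avg_remove[OF assms(1-3), of f] by (simp add: m_def e_def)
  have "var (S - {a}) f = var S f - e * (D - var S f) - e\<^sup>2 * D"
    using avg_square_diff[OF ne(1,2), of f m] unfolding 1 2 D_def by (simp add: power_mult_distrib)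
  then show ?thesis by (simp add: D_def m_def algebra_simps power2_eq_square)
qed

text \<open>The term \<open>x = a\<close> vanishes, which improves the obvious bound
  \<open>u - l\<close> by the factor \<open>(card S - 1) / card S\<close>. In
  \<open>row_step\<close> this matters: times \<open>e = 1 / (R - 1)\<close> the bound becomes
  exactly \<open>(u - l) / R\<close>.\<close>

lemma avg_deviation:
  assumes "finite S" "a \<in> S" "\<And>x. x \<in> S \<Longrightarrow> l \<le> f x" "\<And>x. x \<in> S \<Longrightarrow> f x \<le> u"
  shows "\<bar>f a - avg S f\<bar> \<le> (u - l) * (real (card S) - 1) / real (card S)"
proof -
  have c: "real (card S) > 0" using assms(1,2) by (auto simp: card_gt_0_iff)
  have "f a - avg S f = (\<Sum>x\<in>S. f a - f x) / real (card S)"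
    using c by (simp add: avg_def sum_subtractf field_simps)
  also have "(\<Sum>x\<in>S. f a - f x) = (\<Sum>x\<in>S - {a}. f a - f x)"
    using assms by (simp add: sum.remove)
  finally have eq: "f a - avg S f = (\<Sum>x\<in>S - {a}. f a - f x) / real (card S)" .
  have "\<bar>\<Sum>x\<in>S - {a}. f a - f x\<bar> \<le> (\<Sum>x\<in>S - {a}. u - l)"
    by (rule order_trans[OF sum_abs sum_mono]) (use assms in \<open>fastforce simp: abs_le_iff\<close>)
  also have "\<dots> = (u - l) * (real (card S) - 1)"
    using assms(1,2) by (simp add: of_nat_diff card_gt_0_iff Suc_leI) (metis One_nat_def Suc_leI c mult.commute of_nat_0_less_iff of_nat_1 of_nat_diff)
  finally show ?thesis unfolding eq using c by (simp add: divide_right_mono)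
qed

section \<open>Uniform random bijections, exposed row by row\<close>

definition bijs :: "'a set \<Rightarrow> 'b set \<Rightarrow> ('a \<Rightarrow> 'b) set" where
  "bijs J C = {f \<in> J \<rightarrow>\<^sub>E C. bij_betw f J C}"

lemma finite_bijs: "finite J \<Longrightarrow> finite C \<Longrightarrow> finite (bijs J C)"
  unfolding bijs_def by (simp add: finite_PiE)

lemma bijs_empty: "bijs {} {} = {\<lambda>_. undefined}"
  unfolding bijs_def by (auto simp: bij_betw_def)

text \<open>The inverse stores the value at \<open>j\<close> and resets that argument to
  \<open>undefined\<close>, since members of \<open>bijs\<close> are extensional; this keeps exactly
  one function per bijection.\<close>

lemma bijs_split:
  assumes "j \<in> J"
  shows "bij_betw (\<lambda>(a, f). f(j := a)) (SIGMA a:C. bijs (J - {j}) (C - {a})) (bijs J C)"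
proof (rule bij_betwI[where g = "\<lambda>f. (f j, f(j := undefined))"])
  show "(\<lambda>(a, f). f(j := a)) \<in> (SIGMA a:C. bijs (J - {j}) (C - {a})) \<rightarrow> bijs J C"
  proof (rule funcsetI, clarify)
    fix a f assume a: "a \<in> C" and f: "f \<in> bijs (J - {j}) (C - {a})"
    have "f \<in> (J - {j}) \<rightarrow>\<^sub>E (C - {a})" "bij_betw f (J - {j}) (C - {a})"
      using f by (auto simp: bijs_def)
    then have 1: "f(j := a) \<in> J \<rightarrow>\<^sub>E C"
      using a assms by (auto simp: PiE_iff extensional_def)
    have "bij_betw (f(j := a)) ((J - {j}) \<union> {j}) ((C - {a}) \<union> {a})"
    proof (rule bij_betw_combine)
      show "bij_betw (f(j := a)) (J - {j}) (C - {a})"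
        using \<open>bij_betw f _ _\<close> by (subst bij_betw_cong[of _ _ f]) auto
    qed (auto simp: bij_betw_def)
    then have "bij_betw (f(j := a)) J C"
      using a assms by (simp add: insert_absorb)
    with 1 show "f(j := a) \<in> bijs J C" by (simp add: bijs_def)
  qed
next
  show "(\<lambda>f. (f j, f(j := undefined))) \<in> bijs J C \<rightarrow> (SIGMA a:C. bijs (J - {j}) (C - {a}))"
  proof (rule funcsetI)
    fix f assume "f \<in> bijs J C"
    then have f: "f \<in> J \<rightarrow>\<^sub>E C" "inj_on f J" "f ` J = C" by (auto simp: bijs_def bij_betw_def)
    have "bij_betw f (J - {j}) (C - {f j})"
      unfolding bij_betw_def
    proof
      show "inj_on f (J - {j})" using f by (auto intro: inj_on_subset)
      show "f ` (J - {j}) = C - {f j}" using f assms by (auto simp: inj_on_def)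
    qed
    moreover have "bij_betw (f(j := undefined)) (J - {j}) (C - {f j}) \<longleftrightarrow> bij_betw f (J - {j}) (C - {f j})"
      by (rule bij_betw_cong) simp
    moreover have "f(j := undefined) \<in> (J - {j}) \<rightarrow>\<^sub>E (C - {f j})"
      using f assms by (auto simp: PiE_iff extensional_def inj_on_def)
    ultimately show "(f j, f(j := undefined)) \<in> (SIGMA a:C. bijs (J - {j}) (C - {a}))"
      using f assms by (auto simp: bijs_def)
  qed
next
  show "(\<lambda>f. (f j, f(j := undefined))) ((\<lambda>(a, f). f(j := a)) x) = x"
    if "x \<in> (SIGMA a:C. bijs (J - {j}) (C - {a}))" for x
    using that by (auto simp: bijs_def PiE_iff extensional_def fun_eq_iff)
qed (auto simp: fun_eq_iff)

lemma sum_bijs: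
  assumes "j \<in> J" "finite J" "finite C"
  shows "(\<Sum>f\<in>bijs J C. F f) = (\<Sum>a\<in>C. \<Sum>f\<in>bijs (J - {j}) (C - {a}). F (f(j := a)))"
proof -
  have "(\<Sum>f\<in>bijs J C. F f) = (\<Sum>(a, f)\<in>(SIGMA a:C. bijs (J - {j}) (C - {a})). F (f(j := a)))"
    using sum.reindex_bij_betw[OF bijs_split[OF assms(1)], of F C] by (simp add: case_prod_unfold)
  also have "\<dots> = (\<Sum>a\<in>C. \<Sum>f\<in>bijs (J - {j}) (C - {a}). F (f(j := a)))"
    using assms by (subst sum.Sigma) (auto intro: finite_bijs)
  finally show ?thesis .
qed

lemma card_bijs: "finite J \<Longrightarrow> finite C \<Longrightarrow> card J = card C \<Longrightarrow> card (bijs J C) = fact (card J)"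
proof (induction "card J" arbitrary: J C)
  case 0
  then have "J = {}" "C = {}" by auto
  then show ?case by (simp add: bijs_empty)
next
  case (Suc r)
  then obtain j where j: "j \<in> J" by fastforce
  have "card (bijs J C) = (\<Sum>a\<in>C. card (bijs (J - {j}) (C - {a})))"
    using sum_bijs[OF j Suc.prems(1,2), of "\<lambda>_. 1::nat"] by simp
  also have "\<dots> = (\<Sum>a\<in>C. fact r)"
  proof (rule sum.cong)
    fix a assume "a \<in> C"
    then show "card (bijs (J - {j}) (C - {a})) = fact r"
      using Suc.prems Suc.hyps(2) j Suc.hyps(1)[of "J - {j}" "C - {a}"]
      by (metis card_Diff_singleton diff_Suc_1 finite_Diff)
  qed simp
  finally show ?case using Suc by (metis fact_Suc mult.commute of_nat_id sum_constant)
qed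

lemma bijs_nonempty: "finite J \<Longrightarrow> finite C \<Longrightarrow> card J = card C \<Longrightarrow> bijs J C \<noteq> {}"
  using card_bijs[of J C] by auto

text \<open>The fibres over the value at \<open>j\<close> all have \<open>fact r\<close> members, so
  the overall mean is the mean of the conditional means.\<close>

lemma avg_bijs:
  assumes "j \<in> J" "finite J" "finite C" "card J = card C"
  shows "avg (bijs J C) F = avg C (\<lambda>a. avg (bijs (J - {j}) (C - {a})) (\<lambda>f. F (f(j := a))))"
proof -
  obtain r where r: "card J = Suc r" using assms by (metis card_Suc_Diff1)
  have c: "card (bijs (J - {j}) (C - {a})) = fact r" if "a \<in> C" for a
    using that assms r card_bijs[of "J - {j}" "C - {a}"]
    by (metis card_Diff_singleton diff_Suc_1 finite_Diff)
  have "avg C (\<lambda>a. avg (bijs (J - {j}) (C - {a})) (\<lambda>f. F (f(j := a))))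
      = avg C (\<lambda>a. (\<Sum>f\<in>bijs (J - {j}) (C - {a}). F (f(j := a))) / fact r)"
    by (rule avg_cong) (simp_all add: avg_def c)
  moreover have "real (card (bijs J C)) = real (card C) * fact r"
    using assms r by (simp add: card_bijs) (metis fact_Suc of_nat_mult of_nat_fact)
  ultimately show ?thesis
    by (simp add: avg_def sum_bijs[OF assms(1-3)] sum_divide_distrib[symmetric] mult.commute)
qed

lemma avg_bijs_marginal:
  assumes "j \<in> J" "finite J" "finite C" "card J = card C"
  shows "avg (bijs J C) (\<lambda>f. F (f j)) = avg C F"
  unfolding avg_bijs[OF assms]
proof (rule avg_cong)
  fix a assume "a \<in> C"
  then show "avg (bijs (J - {j}) (C - {a})) (\<lambda>f. F ((f(j := a)) j)) = F a"
    using assms by (simp add: avg_const finite_bijs bijs_nonempty)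
qed simp

section \<open>A permanent inequality\<close>

lemma exp_le_quadratic:
  fixes u :: real
  assumes "u \<le> 1/3"
  shows "exp u \<le> 1 + u + 3/5 * u\<^sup>2"
proof -
  obtain t where t: "\<bar>t\<bar> \<le> \<bar>u\<bar>" and e: "exp u = (\<Sum>m<3. u ^ m / fact m) + exp t / fact 3 * u ^ 3"
    using Maclaurin_exp_le[of u 3] by blast
  have e3: "exp u = 1 + u + u\<^sup>2 / 2 + exp t / 6 * u ^ 3"
    unfolding e by (simp add: eval_nat_numeral fact_numeral)
  show ?thesis
  proof (cases "u \<le> 0")
    case True
    \<comment> \<open>For negative \<open>u\<close> the cubic remainder has the right sign. The
      bound thus reaches all negative arguments; \<open>row_step\<close> applies it to
      \<open>- d\<close>, where only a lower bound on \<open>d\<close> is at hand.\<close>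
    then have "u ^ 3 \<le> 0" by (simp add: power_le_zero_eq)
    then have "exp t / 6 * u ^ 3 \<le> 0" by (simp add: mult_nonneg_nonpos)
    then show ?thesis using e3 zero_le_power2[of u] by linarith
  next
    case False
    have "exp t \<le> exp (1/3)" using t assms False by simp
    also have "\<dots> \<le> 1 + 1/3 + (1/3)\<^sup>2" by (rule exp_bound) auto
    also have "\<dots> \<le> 3/2" by (simp add: power2_eq_square)
    finally have "exp t * u \<le> 3/2 * (1/3)"
      using assms False by (intro mult_mono) auto
    then have "exp t * u / 6 * u\<^sup>2 \<le> 1/10 * u\<^sup>2"
      by (intro mult_right_mono zero_le_power2) linarith
    then show ?thesis using e3 by (simp add: power3_eq_cube power2_eq_square field_simps)
  qed
qed

text \<open>An upper bound, of order \<open>1 / sqrt r\<close>, for the cost per unit of row variance of using a bijection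
  on \<open>r\<close> rows instead of independent entries. The values for \<open>r \<le> 3\<close> are chosen so that the induction
  step \<open>row_loss_step\<close> also holds for small \<open>r\<close>.\<close>

definition row_loss :: "nat \<Rightarrow> real" where
  "row_loss r = (if r \<le> 2 then 3/5 else if r = 3 then 2/3 else 4 / (4 + sqrt (real r)))"

text \<open>One row with mean \<open>b\<close>, variance \<open>v\<close> and factor \<open>b + g * v\<close>, when a column with entry \<open>b + x\<close> is
  deleted: \<open>1 + d\<close> is the ratio of the new factor to the old one.\<close>

lemma row_step:
  fixes R e g g' b x v :: real
  assumes R: "R \<ge> 3" and e: "e = 1 / (R - 1)"
    and g: "0 \<le> g" "0 \<le> g'" "g' \<le> 2/3" "0 \<le> k" "k = g' * (1 + e) - g"
    and b: "1 \<le> b" "1 \<le> b + x" "b + x \<le> 9/7" and x: "\<bar>x\<bar> \<le> 2/7 * (R - 1) / R"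
    and v: "0 \<le> v" "v \<le> 1/49"
    and cx: "cx = 6/5 * e + 27/35 * 36/25 * e\<^sup>2"
    and cv: "cv = 2/7 * (R - 1) / R * (k + g * e) + g * k / 49 + 27/35 * (24/35 * k / R + k\<^sup>2 / 49)"
    and d: "d = (b - e * x + g' * (1 + e) * (v - e * x\<^sup>2)) / (b + g * v) - 1"
  shows "1 / R * ((b + x) / (b + g * v)) * exp (- d)
      \<le> 1 / R - d + ((g' - g + cv / R) * v - (g' * e - cx / R) * x\<^sup>2) / (b + g * v)"
    and "d \<ge> - (12 / (35 * R))"
proof -
  define f where "f = b + g * v"
  have f1: "f \<ge> 1" using b g v by (simp add: f_def add_increasing2)
  define X where "X = 2/7 * (R - 1) / R"
  have eR: "e * (R - 1) = 1" using R by (simp add: e)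
  have e0: "e > 0" using R by (simp add: e)
  have X0: "X \<ge> 0" using R by (simp add: X_def)
  have "e * X = 2/7 * (e * (R - 1)) / R" by (simp add: X_def)
  then have eX: "e * X = 2 / (7 * R)" by (simp add: eR)
  have "(1 + e) * (R - 1) = R" using eR by (simp add: algebra_simps)
  moreover have "(1 + e) * X = 2/7 * ((1 + e) * (R - 1)) / R" by (simp add: X_def)
  ultimately have X1: "(1 + e) * X = 2/7" using R by simp
  define s where "s = g' * (1 + e)"
  have s0: "s \<ge> 0" using g e0 by (simp add: s_def)
  have sX: "s * X \<le> 1/5"
  proof -
    have "s * X = g' * ((1 + e) * X)" by (simp add: s_def)
    then show ?thesis unfolding X1 using g by simp
  qed
  have x': "\<bar>x\<bar> \<le> X" using x by (simp add: X_def)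
  have sx: "\<bar>s * x\<bar> \<le> 1/5"
    using mult_left_mono[OF x' s0] sX s0 by (simp add: abs_mult)
  \<comment> \<open>\<open>f + D\<close> is the row factor after the deletion:
    \<open>- e * x\<close> is the shift of the mean, the rest comes from the variance term.\<close>
  define D where "D = - e * (x * (1 + s * x)) + k * v"
  have dD: "d = D / f"
  proof -
    have "b - e * x + g' * (1 + e) * (v - e * x\<^sup>2) = f + D"
      by (simp add: D_def f_def s_def g(5) algebra_simps power2_eq_square)
    then show ?thesis using f1 unfolding d f_def[symmetric] by (simp add: add_divide_distrib)
  qed
  have kv: "k * v \<ge> 0" using g v by simp
  have xx: "\<bar>x * (1 + s * x)\<bar> \<le> 6/5 * \<bar>x\<bar>"
    unfolding abs_mult using sx by (subst mult.commute, intro mult_right_mono) auto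
  also have "\<dots> \<le> 6/5 * X" using x' by simp
  finally have xX: "\<bar>x * (1 + s * x)\<bar> \<le> 6/5 * X" .
  have "e * (x * (1 + s * x)) \<le> e * (6/5 * X)"
    using xX e0 by (intro mult_left_mono) auto
  also have "\<dots> = 12 / (35 * R)" using eX by (simp add: algebra_simps)
  finally have D: "D \<ge> - (12 / (35 * R))" using kv by (simp add: D_def)
  show dge: "d \<ge> - (12 / (35 * R))"
  proof -
    have "1 * (12 / (35 * R)) \<le> f * (12 / (35 * R))" using f1 R by (intro mult_right_mono) auto
    with D have "- (12 / (35 * R)) * f \<le> D" by (simp add: mult.commute)
    then show ?thesis using f1 by (simp add: dD pos_le_divide_eq)
  qed
  have "12 / (35 * R) \<le> 1/3" using R by (simp add: field_simps)
  then have ex: "exp (- d) \<le> 1 - d + 3/5 * d\<^sup>2"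
    using exp_le_quadratic[of "- d"] dge by simp
  \<comment> \<open>The entry over its row factor. Its bound 9/7 turns the 3/5 of
    \<open>exp_le_quadratic\<close> into the 27/35 in \<open>cx\<close> and
    \<open>cv\<close>.\<close>
  define w where "w = (b + x) / f"
  have w: "0 \<le> w" "w \<le> 9/7" using b f1 by (auto simp: w_def field_simps)
  have wf: "w * f = b + x" using f1 by (simp add: w_def)
  have D2: "D\<^sup>2 \<le> 36/25 * e\<^sup>2 * x\<^sup>2 + (24/35 * k / R + k\<^sup>2 / 49) * v"
  proof -
    have "D\<^sup>2 = e\<^sup>2 * (x * (1 + s * x))\<^sup>2 - 2 * (e * (x * (1 + s * x))) * (k * v) + k\<^sup>2 * v * v"
      by (simp add: D_def power2_eq_square algebra_simps)
    moreover have "(x * (1 + s * x))\<^sup>2 \<le> (6/5 * \<bar>x\<bar>)\<^sup>2"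
      using xx by (metis abs_ge_zero power2_abs power_mono)
    then have "e\<^sup>2 * (x * (1 + s * x))\<^sup>2 \<le> e\<^sup>2 * (36/25 * x\<^sup>2)"
      by (intro mult_left_mono) (auto simp: power_mult_distrib power2_eq_square)
    moreover have "- 2 * (e * (x * (1 + s * x))) * (k * v) \<le> 2 * (12 / (35 * R)) * (k * v)"
    proof (rule mult_right_mono[OF _ kv])
      have "- (e * (x * (1 + s * x))) \<le> e * (6/5 * X)"
        using xX e0 mult_left_mono[of "- (x * (1 + s * x))" "6/5 * X" e] by (simp add: abs_le_iff)
      then show "- 2 * (e * (x * (1 + s * x))) \<le> 2 * (12 / (35 * R))"
        using eX by (simp add: algebra_simps)
    qed
    moreover have "k\<^sup>2 * v * v \<le> k\<^sup>2 * v * (1/49)"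
      using v by (intro mult_left_mono) auto
    ultimately show ?thesis by (simp add: algebra_simps)
  qed
  define Y where "Y = cx * x\<^sup>2 + cv * v"
  have T: "- (x - g * v) * D + 3/5 * w * D\<^sup>2 \<le> Y"
  proof -
    have "- (x - g * v) * D = e * x\<^sup>2 + (s * x) * (e * x\<^sup>2) - (k + g * e) * x * v + g * k * v * v - g * s * e * v * x\<^sup>2"
      by (simp add: D_def power2_eq_square algebra_simps)
    moreover have "(s * x) * (e * x\<^sup>2) \<le> 1/5 * (e * x\<^sup>2)"
      using sx e0 by (intro mult_right_mono) auto
    moreover have "- (k + g * e) * x * v \<le> X * (k + g * e) * v"
    proof (rule mult_right_mono[OF _ v(1)])
      have "0 \<le> k + g * e" using g e0 by simp
      then have "(k + g * e) * (- x) \<le> (k + g * e) * X"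
        using x' by (intro mult_left_mono) auto
      then show "- (k + g * e) * x \<le> X * (k + g * e)" by (simp add: algebra_simps)
    qed
    moreover have "g * k * v * v \<le> g * k * v * (1/49)"
      using v g by (intro mult_left_mono) auto
    moreover have "0 \<le> g * s * e * v * x\<^sup>2" using g s0 e0 v by simp
    moreover have "3/5 * w * D\<^sup>2 \<le> 27/35 * D\<^sup>2"
      using w by (intro mult_right_mono) auto
    moreover have "27/35 * D\<^sup>2 \<le> 27/35 * (36/25 * e\<^sup>2 * x\<^sup>2 + (24/35 * k / R + k\<^sup>2 / 49) * v)"
      using D2 by simp
    ultimately show ?thesis
      unfolding Y_def cx cv X_def by (simp add: algebra_simps)
  qed
  have cx0: "cx \<ge> 0" using e0 by (simp add: cx)
  have "0 \<le> 2/7 * (R - 1) / R * (k + g * e)"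
    using R g e0 by (auto intro!: divide_nonneg_nonneg mult_nonneg_nonneg)
  then have cv0: "cv \<ge> 0" using g R by (auto simp: cv intro!: add_nonneg_nonneg)
  have Y0: "Y \<ge> 0" using cx0 cv0 v by (simp add: Y_def)
  have "1 / R * w * exp (- d) * f \<le> 1 / R * w * (1 - d + 3/5 * d\<^sup>2) * f"
    using w R f1 ex by (intro mult_right_mono mult_left_mono) auto
  also have "\<dots> = 1 / R * (w * f - w * f * d + 3/5 * w * d\<^sup>2 * f)"
    by (simp add: algebra_simps)
  also have "w * f - w * f * d + 3/5 * w * d\<^sup>2 * f
      = f + (x - g * v) - D + (- (x - g * v) * D + 3/5 * w * D\<^sup>2) / f"
  proof -
    have "d * f = D" using f1 by (simp add: dD)
    have "w * f - w * f * d = f + (x - g * v) - (f + (x - g * v)) * d"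
    proof -
      have wf': "w * f = f + (x - g * v)" unfolding wf by (simp add: f_def)
      show ?thesis unfolding wf' by (simp add: algebra_simps)
    qed
    also have "\<dots> = f + (x - g * v) - D - (x - g * v) * D / f"
      using f1 by (simp add: dD distrib_right add_divide_distrib)
    moreover have "3/5 * w * d\<^sup>2 * f = 3/5 * w * D\<^sup>2 / f"
      using f1 by (simp add: dD power2_eq_square)
    moreover have "(- (x - g * v) * D + 3/5 * w * D\<^sup>2) / f = 3/5 * w * D\<^sup>2 / f - (x - g * v) * D / f"
      by (simp only: add_divide_distrib mult_minus_left divide_minus_left)
    ultimately show ?thesis by linarith
  qed
  also have "1 / R * \<dots> \<le> 1 / R * (f + (x - g * v) - D + Y)"
  proof -
    have "(- (x - g * v) * D + 3/5 * w * D\<^sup>2) / f \<le> Y / f"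
      using T f1 by (intro divide_right_mono) auto
    also have "\<dots> \<le> Y" using f1 Y0 by (simp add: divide_le_eq mult_le_cancel_left1)
    finally show ?thesis using R by (intro mult_left_mono) auto
  qed
  also have "\<dots> = f / R - D + ((g' - g + cv / R) * v - (g' * e - cx / R) * x\<^sup>2)"
  proof -
    have R0: "R \<noteq> 0" using R by simp
    \<comment> \<open>\<open>e * (R - 1) = 1\<close> makes the first-order parts match: up to
      multiples of \<open>v\<close> and \<open>x^2\<close>, \<open>x\<close> is
      \<open>- (R - 1) * D\<close>. So \<open>x - D\<close> turns into \<open>- R * D\<close>, which
      is the \<open>- d\<close> of the claim after division by \<open>R * f\<close>.\<close>
    have "(R - 1) * D = - x - s * x\<^sup>2 + (R * g' - (R - 1) * g) * v"
    proof -
      have DR: "(R - 1) * D = - (e * (R - 1)) * (x * (1 + s * x)) + ((R - 1) * k) * v"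
        by (simp add: D_def algebra_simps)
      have kR: "(R - 1) * k = g' * ((1 + e) * (R - 1)) - (R - 1) * g"
        by (simp add: g(5) algebra_simps)
      show ?thesis
        unfolding DR kR eR \<open>(1 + e) * (R - 1) = R\<close> by (simp add: power2_eq_square algebra_simps)
    qed
    moreover have "s = R * (g' * e)"
    proof -
      have "1 + e = R * e" using eR by (simp add: algebra_simps)
      then show ?thesis by (simp add: s_def)
    qed
    ultimately have "x - g * v - D + Y = R * (- D + ((g' - g + cv / R) * v - (g' * e - cx / R) * x\<^sup>2))"
      using R0 by (simp add: Y_def algebra_simps)
    then have eq: "f + (x - g * v) - D + Y = f + R * (- D + ((g' - g + cv / R) * v - (g' * e - cx / R) * x\<^sup>2))"
      by linarith
    show ?thesis unfolding eq using R0 by (simp add: distrib_left)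
  qed
  finally have "1 / R * w * exp (- d) * f \<le> \<dots>" .
  then have "1 / R * w * exp (- d) \<le> (f / R - D + ((g' - g + cv / R) * v - (g' * e - cx / R) * x\<^sup>2)) / f"
    using f1 by (simp add: pos_le_divide_eq)
  also have "\<dots> = 1 / R - d + ((g' - g + cv / R) * v - (g' * e - cx / R) * x\<^sup>2) / f"
    using f1 by (simp add: dD add_divide_distrib diff_divide_distrib)
  finally show "1 / R * ((b + x) / (b + g * v)) * exp (- d)
      \<le> 1 / R - d + ((g' - g + cv / R) * v - (g' * e - cx / R) * x\<^sup>2) / (b + g * v)"
    by (simp only: w_def f_def)
qed

lemma row_loss_pos: "row_loss r > 0"
  by (simp add: row_loss_def add_pos_nonneg)

text \<open>After averaging over the column, \<open>permanent_step\<close> weighs the gain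
  \<open>7/10 * N\<close> with \<open>N = g' * e - cx / R\<close> against the loss
  \<open>101/100 * P\<close> with \<open>P = g' - g + cv / R\<close>, both multiplying the same sum
  of variances. For a decay like \<open>1 / sqrt r\<close> the difference \<open>g' - g\<close> is
  at most half of \<open>g' * e\<close>, safely below 7/10, and the terms with \<open>cx / R\<close>
  and \<open>cv / R\<close> are of lower order for large \<open>r\<close>.\<close>

lemma row_loss_step:
  fixes r :: nat
  assumes r: "r \<ge> 3" and R: "R = real r" and e: "e = 1 / (R - 1)"
    and g: "g = row_loss r" "g' = row_loss (r - 1)" and k: "k = g' * (1 + e) - g"
    and cx: "cx = 6/5 * e + 27/35 * 36/25 * e\<^sup>2"
    and cv: "cv = 2/7 * (R - 1) / R * (k + g * e) + g * k / 49 + 27/35 * (24/35 * k / R + k\<^sup>2 / 49)"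
  shows "g' \<le> 2/3 \<and> 0 \<le> k \<and> 0 \<le> g' * e - cx / R
    \<and> (g' - g + cv / R \<le> 0 \<or> 101/100 * (g' - g + cv / R) \<le> 7/10 * (g' * e - cx / R))"
proof -
  consider "r = 3" | "r = 4" | "r \<ge> 5" using r by linarith
  then show ?thesis
  proof cases
    \<comment> \<open>The values \<open>row_loss 2 = 3/5\<close> and \<open>row_loss 3 = 2/3\<close>
      are exceptional; the general formula covers both \<open>r\<close> and \<open>r - 1\<close>
      from \<open>r = 5\<close> on.\<close>
    case 1
    have *: "R = 3" "e = 1/2" "g = 2/3" "g' = 3/5" using 1 by (simp_all add: R e g row_loss_def)
    show ?thesis unfolding k cx cv * by (simp add: power2_eq_square)
  next
    case 2
    have "sqrt 4 = (2::real)" by (rule real_sqrt_unique) auto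
    then have *: "R = 4" "e = 1/3" "g = 2/3" "g' = 2/3" using 2 by (simp_all add: R e g row_loss_def)
    show ?thesis unfolding k cx cv * by (simp add: power2_eq_square)
  next
    case 3
    define q where "q = sqrt (R - 1)"
    define p where "p = sqrt R"
    have R5: "R \<ge> 5" using 3 by (simp add: R)
    have "sqrt 4 = (2::real)" by (rule real_sqrt_unique) auto
    then have q: "q \<ge> 2" using R5 real_sqrt_le_mono[of 4 "R - 1"] by (simp add: q_def)
    have q2: "q\<^sup>2 = R - 1" and p2: "p\<^sup>2 = R" using R5 by (simp_all add: q_def p_def)
    have pq: "p \<ge> q" by (simp add: p_def q_def)
    have e0: "e > 0" "e \<le> 1/4" using R5 by (simp_all add: e field_simps)
    have g'q: "g' = 4 / (4 + q)"
    proof -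
      have "\<not> r - 1 \<le> 2" "r - 1 \<noteq> 3" "real (r - 1) = R - 1" using 3 by (auto simp: R of_nat_diff)
      then show ?thesis by (simp only: g row_loss_def q_def if_False)
    qed
    have gp: "g = 4 / (4 + p)" using 3 by (simp add: g row_loss_def p_def R)
    have g0: "g > 0" "g' > 0" using q pq by (simp_all add: g'q gp)
    have g23: "g' \<le> 2/3" using q by (simp add: g'q field_simps)
    have gg: "g \<le> g'" using q pq unfolding g'q gp by (intro divide_left_mono) auto
    have eq: "e * q\<^sup>2 = 1" using R5 by (simp add: e q2)
    define Q where "Q = q / (2 * (4 + q))"
    have Q: "Q \<le> 1/2" using q by (simp add: Q_def field_simps)
    have diff: "g' - g \<le> g' * e * Q"
    proof -
      have "(p - q) * (p + q) = 1" using q2 p2 by (simp add: power2_eq_square algebra_simps)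
      then have pd: "p - q = 1 / (p + q)" using q pq by (simp add: field_simps)
      also have "\<dots> \<le> 1 / (2 * q)" using q pq by (intro divide_left_mono) auto
      also have "\<dots> = e * q / 2" using eq q by (simp add: field_simps power2_eq_square)
      finally have "p - q \<le> e * q / 2" .
      have "g' - g = g' * ((p - q) / (4 + p))"
        using q pq by (simp add: g'q gp field_simps)
      also have "(p - q) / (4 + p) \<le> (e * q / 2) / (4 + q)"
        using \<open>p - q \<le> e * q / 2\<close> q pq e0 by (intro frac_le) auto
      also have "\<dots> = e * Q" by (simp add: Q_def)
      finally show ?thesis using g0 by (simp add: mult.assoc)
    qed
    have eg: "g' * e > 0" using g0 e0 by simp
    have k_eq: "k = g' * e + (g' - g)" by (simp add: k algebra_simps)
    have "g' * e * Q \<le> g' * e * (1/2)" using Q eg by (intro mult_left_mono) auto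
    then have k32: "k \<le> 3/2 * (g' * e)" using diff k_eq by linarith
    have k0: "k \<ge> 0" using k_eq gg eg by linarith
    have eg4: "g' * e \<le> 1/6" using mult_mono[OF g23 e0(2)] g0 e0 by simp
    have "2/7 * (R - 1) / R \<le> 2/7" using R5 by (simp add: field_simps)
    moreover have "k + g * e \<le> 5/2 * (g' * e)"
      using k32 mult_right_mono[OF gg, of e] e0 by linarith
    moreover have "0 \<le> k + g * e" using k0 g0 e0 by simp
    ultimately have c1: "2/7 * (R - 1) / R * (k + g * e) \<le> 2/7 * (5/2 * (g' * e))"
      using R5 by (intro mult_mono) auto
    have "g * k \<le> 2/3 * (3/2 * (g' * e))"
      using gg g23 k32 k0 by (intro mult_mono) auto
    then have c2: "g * k / 49 \<le> g' * e / 49" by (simp add: mult.commute)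
    have "k / R \<le> k / 5" using R5 k0 by (intro divide_left_mono) auto
    moreover have "24/35 * k / R = 24/35 * (k / R)" by simp
    ultimately have c3: "24/35 * k / R \<le> 24/175 * (3/2 * (g' * e))" using k32 by linarith
    have "k \<le> 1/4" using k32 eg4 by linarith
    then have "k * k \<le> k * (1/4)" using k0 by (intro mult_left_mono) auto
    then have c4: "k\<^sup>2 / 49 \<le> 1/196 * (3/2 * (g' * e))" using k32 by (simp add: power2_eq_square)
    have cv1: "cv \<le> g' * e"
    proof -
      have "A + B + 27/35 * (c + D) \<le> t"
        if "A \<le> 2/7 * (5/2 * t)" "B \<le> t / 49" "c \<le> 24/175 * (3/2 * t)" "D \<le> 1/196 * (3/2 * t)" "0 < t"
        for A B c D t :: real
        using that by argo
      from this[OF c1 c2 c3 c4 eg] show ?thesis unfolding cv .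
    qed
    have "e\<^sup>2 \<le> e * (1/4)" using e0 by (simp add: power2_eq_square)
    then have cx1: "cx \<le> 3/2 * e" using e0 by (simp add: cx)
    have "cx / R \<le> 3/2 * e / R" using cx1 R5 by (intro divide_right_mono) auto
    also have "3/2 * e / R = g' * e * (3/8 * (4 + q) / R)"
    proof -
      have "g' * (4 + q) = 4" using q unfolding g'q by (subst nonzero_eq_divide_eq[symmetric]) auto
      moreover have "g' * e * (3/8 * (4 + q) / R) = 3/8 * (g' * (4 + q)) * e / R" by simp
      ultimately show ?thesis by simp
    qed
    finally have N: "g' * e - cx / R \<ge> g' * e * (1 - 3/8 * (4 + q) / R)" by (simp add: algebra_simps)
    have "cv / R \<le> g' * e / R" using cv1 R5 by (intro divide_right_mono) auto
    then have P: "g' - g + cv / R \<le> g' * e * (Q + 1 / R)" using diff by (simp add: algebra_simps)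
    have main: "101/100 * (Q + 1 / R) \<le> 7/10 * (1 - 3/8 * (4 + q) / R)"
    proof -
      have RR: "R = q\<^sup>2 + 1" using q2 by simp
      \<comment> \<open>Clearing denominators leaves a cubic in \<open>q\<close>; after the shift to
        \<open>y \<ge> 0\<close> all its coefficients are nonnegative.\<close>
      define y where "y = q - 2"
      have y: "y \<ge> 0" "q = y + 2" using q by (simp_all add: y_def)
      have "7/10 * (2 * (4 + q) * R - 3/4 * (4 + q) * (4 + q)) = 101/100 * (q * R + 2 * (4 + q))
          + (39/100 * y ^ 3 + 1483/200 * y\<^sup>2 + 383/20 * y + 22/25)"
        unfolding RR y(2) by (simp add: power2_eq_square power3_eq_cube field_simps)
      moreover have "0 \<le> 39/100 * y ^ 3 + 1483/200 * y\<^sup>2 + 383/20 * y + 22/25"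
        using y(1) by (intro add_nonneg_nonneg mult_nonneg_nonneg) auto
      ultimately have "101/100 * (q * R + 2 * (4 + q)) \<le> 7/10 * (2 * (4 + q) * R - 3/4 * (4 + q) * (4 + q))"
        by linarith
      then have "101/100 * (q * R + 2 * (4 + q)) / (2 * (4 + q) * R)
          \<le> 7/10 * (2 * (4 + q) * R - 3/4 * (4 + q) * (4 + q)) / (2 * (4 + q) * R)"
        using q R5 by (intro divide_right_mono) auto
      moreover have "101/100 * (q * R + 2 * (4 + q)) / (2 * (4 + q) * R) = 101/100 * (Q + 1 / R)"
      proof -
        have "(q * R + u) / (u * R) = q / u + 1 / R" if "u \<noteq> 0" for u
          using that R5 by (simp add: add_divide_distrib)
        from this[of "2 * (4 + q)"] have "(q * R + 2 * (4 + q)) / (2 * (4 + q) * R) = Q + 1 / R"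
          using q by (simp add: Q_def)
        then show ?thesis by (metis times_divide_eq_right)
      qed
      moreover have "7/10 * (2 * (4 + q) * R - 3/4 * (4 + q) * (4 + q)) / (2 * (4 + q) * R)
          = 7/10 * (1 - 3/8 * (4 + q) / R)"
      proof -
        have "(2 * w * R - 3/4 * w * w) / (2 * w * R) = 1 - 3/8 * w / R" if "w \<noteq> 0" for w
          using that R5 by (simp add: diff_divide_distrib)
        from this[of "4 + q"] have "(2 * (4 + q) * R - 3/4 * (4 + q) * (4 + q)) / (2 * (4 + q) * R) = 1 - 3/8 * (4 + q) / R"
          using q by linarith
        then show ?thesis by (metis times_divide_eq_right)
      qed
      ultimately show ?thesis by (simp only:)
    qed
    have "0 \<le> Q + 1 / R" using q R5 by (simp add: Q_def)
    moreover have "0 \<le> B" if "101/100 * A \<le> 7/10 * B" "0 \<le> A" for A B :: real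
      using that by argo
    ultimately have "0 \<le> 1 - 3/8 * (4 + q) / R" using main by blast
    then have "0 \<le> g' * e * (1 - 3/8 * (4 + q) / R)" using g0 e0 by (intro mult_nonneg_nonneg) auto
    then have N0: "0 \<le> g' * e - cx / R" using N by linarith
    have "101/100 * P \<le> 7/10 * N"
      if "P \<le> t * A" "t * B \<le> N" "101/100 * A \<le> 7/10 * B" "0 < t" for P N t A B :: real
    proof -
      have "t * (101/100 * A) \<le> t * (7/10 * B)" using that(3,4) by (intro mult_left_mono) auto
      moreover have "t * (101/100 * A) = 101/100 * (t * A)" "t * (7/10 * B) = 7/10 * (t * B)" by simp_all
      ultimately show ?thesis using that(1,2) by argo
    qed
    from this[OF P N main eg]
    show ?thesis using g23 k0 N0 by (intro conjI disjI2)
  qed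
qed

lemma prod_le_exp_sum:
  fixes f :: "'a \<Rightarrow> real"
  assumes "finite A" "\<And>x. x \<in> A \<Longrightarrow> 0 \<le> 1 + f x"
  shows "(\<Prod>x\<in>A. 1 + f x) \<le> exp (\<Sum>x\<in>A. f x)"
  unfolding exp_sum[OF assms(1)] by (rule prod_mono) (use assms in auto)

text \<open>Averaging over the row that is exposed makes the first-order terms cancel, because
  \<open>exp D * (1 - D) \<le> 1\<close> for the sum \<open>D\<close> of the relative changes; only variances survive.\<close>

lemma permanent_step:
  assumes fin: "finite J" "finite C" and card: "card J = card C" and r: "card J \<ge> 3"
    and b: "\<And>j a. j \<in> J \<Longrightarrow> a \<in> C \<Longrightarrow> 1 \<le> b j a \<and> b j a \<le> 9/7"
  shows "avg J (\<lambda>j. avg C (\<lambda>a. b j a *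
      (\<Prod>l\<in>J - {j}. avg (C - {a}) (b l) + row_loss (card J - 1) * var (C - {a}) (b l))))
    \<le> (\<Prod>j\<in>J. avg C (b j) + row_loss (card J) * var C (b j))"
proof -
  define r where "r = card J"
  define R where "R = real r"
  define e where "e = 1 / (R - 1)"
  define g where "g = row_loss r"
  define g' where "g' = row_loss (r - 1)"
  define k where "k = g' * (1 + e) - g"
  define cx where "cx = 6/5 * e + 27/35 * 36/25 * e\<^sup>2"
  define cv where "cv = 2/7 * (R - 1) / R * (k + g * e) + g * k / 49 + 27/35 * (24/35 * k / R + k\<^sup>2 / 49)"
  define P where "P = g' - g + cv / R"
  define N where "N = g' * e - cx / R"
  have r3: "r \<ge> 3" "R \<ge> 3" using r by (simp_all add: r_def R_def)
  have gs: "g' \<le> 2/3" "0 \<le> k" "0 \<le> N" "P \<le> 0 \<or> 101/100 * P \<le> 7/10 * N"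
    using row_loss_step[OF r3(1) R_def e_def g_def g'_def k_def cx_def cv_def] unfolding P_def N_def by blast+
  have g0: "0 < g" "0 < g'" by (simp_all add: g_def g'_def row_loss_pos)
  have e0: "e > 0" using r3 by (simp add: e_def)
  have ne: "J \<noteq> {}" "C \<noteq> {}" using fin card r3 by (auto simp: r_def)
  define m where "m = (\<lambda>j. avg C (b j))"
  define x where "x = (\<lambda>j a. b j a - m j)"
  define v where "v = (\<lambda>j. var C (b j))"
  define f where "f = (\<lambda>j. m j + g * v j)"
  define d where "d = (\<lambda>j a. (m j - e * x j a + g' * (1 + e) * (v j - e * (x j a)\<^sup>2)) / f j - 1)"
  have m1: "1 \<le> m j" if "j \<in> J" for j
    unfolding m_def by (rule avg_ge) (use fin ne b that in auto)
  have v0: "0 \<le> v j" for j by (simp add: v_def var_nonneg)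
  have v1: "v j \<le> 1/49" if "j \<in> J" for j
  proof -
    have "v j \<le> ((9/7 - 1) / 2)\<^sup>2"
      unfolding v_def by (rule var_le_of_range) (use fin ne b that in auto)
    then show ?thesis by (simp add: power2_eq_square)
  qed
  have f1: "1 \<le> f j" if "j \<in> J" for j
    using m1[OF that] v0[of j] g0 by (simp add: f_def add_increasing2)
  have xb: "\<bar>x j a\<bar> \<le> 2/7 * (R - 1) / R" if "j \<in> J" "a \<in> C" for j a
    using avg_deviation[OF fin(2) that(2), of 1 "b j" "9/7"] b that
    by (simp add: x_def m_def R_def r_def card)
  have sub: "avg (C - {a}) (b l) + g' * var (C - {a}) (b l) = f l * (1 + d l a)" if "l \<in> J" "a \<in> C" for l a
  proof -
    have c2: "card C \<ge> 2" using r3 card by (simp add: r_def)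
    have e': "e = 1 / (real (card C) - 1)" by (simp add: e_def R_def r_def card)
    show ?thesis
      using f1[OF that(1)] avg_remove[OF fin(2) that(2) c2, of "b l"] var_remove[OF fin(2) that(2) c2, of "b l"]
      by (simp add: d_def e'[symmetric] x_def m_def v_def mult.commute[of _ "f l"])
        (simp add: e' m_def)
  qed
  have rs: "1 / R * (b j a / f j) * exp (- d j a) \<le> 1 / R - d j a + (P * v j - N * (x j a)\<^sup>2) / f j"
    and dl: "d j a \<ge> - (12 / (35 * R))" if "j \<in> J" "a \<in> C" for j a
  proof -
    have "1 \<le> m j + x j a" "m j + x j a \<le> 9/7" using b[OF that] by (simp_all add: x_def)
    note * = row_step[OF r3(2) e_def less_imp_le[OF g0(1)] less_imp_le[OF g0(2)] gs(1,2) k_def m1[OF that(1)] this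
        xb[OF that] v0 v1[OF that(1)] cx_def cv_def]
    show "1 / R * (b j a / f j) * exp (- d j a) \<le> 1 / R - d j a + (P * v j - N * (x j a)\<^sup>2) / f j"
      using *(1)[of "d j a"] by (simp add: d_def f_def P_def N_def x_def)
    show "d j a \<ge> - (12 / (35 * R))"
      using *(2)[of "d j a"] by (simp add: d_def f_def)
  qed
  have d1: "0 \<le> 1 + d j a" if "j \<in> J" "a \<in> C" for j a
  proof -
    have "12 / (35 * R) \<le> 1" using r3 by (simp add: field_simps)
    then show ?thesis using dl[OF that] by linarith
  qed
  define F where "F = (\<Prod>j\<in>J. f j)"
  have F0: "F > 0" unfolding F_def by (rule prod_pos) (use f1 in force)
  define V where "V = (\<Sum>j\<in>J. v j / f j)"
  have V0: "V \<ge> 0" unfolding V_def by (intro sum_nonneg divide_nonneg_nonneg) (use v0 f1 in force)+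
  have col: "(\<Sum>j\<in>J. b j a * (\<Prod>l\<in>J - {j}. f l * (1 + d l a))) / R
      \<le> F * (exp (P * V) - 7/10 * N * (\<Sum>j\<in>J. (x j a)\<^sup>2 / f j))" if a: "a \<in> C" for a
  proof -
    define D where "D = (\<Sum>j\<in>J. d j a)"
    define Q where "Q = (\<Sum>j\<in>J. (x j a)\<^sup>2 / f j)"
    have Q0: "Q \<ge> 0" unfolding Q_def by (intro sum_nonneg divide_nonneg_nonneg) (use f1 in force)+
    have "b j a * (\<Prod>l\<in>J - {j}. f l * (1 + d l a)) / R
        \<le> F * exp D * (1 / R * (b j a / f j) * exp (- d j a))" if j: "j \<in> J" for j
    proof -
      have Fj: "(\<Prod>l\<in>J - {j}. f l) = F / f j"
        using f1[OF j] fin(1) j by (simp add: F_def prod.remove)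
      have Dj: "(\<Sum>l\<in>J - {j}. d l a) = D - d j a"
        using fin(1) j by (simp add: D_def sum.remove)
      have "(\<Prod>l\<in>J - {j}. f l * (1 + d l a)) = F / f j * (\<Prod>l\<in>J - {j}. 1 + d l a)"
        by (simp add: prod.distrib Fj)
      also have "\<dots> \<le> F / f j * exp (D - d j a)"
        unfolding Dj[symmetric] using F0 f1[OF j] d1 a fin(1)
        by (intro mult_left_mono prod_le_exp_sum) auto
      finally have "b j a / R * (\<Prod>l\<in>J - {j}. f l * (1 + d l a)) \<le> b j a / R * (F / f j * exp (D - d j a))"
        using b[OF j a] r3 by (intro mult_left_mono) auto
      then show ?thesis by (simp add: exp_diff exp_minus field_simps)
    qed
    then have "(\<Sum>j\<in>J. b j a * (\<Prod>l\<in>J - {j}. f l * (1 + d l a))) / R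
        \<le> F * exp D * (\<Sum>j\<in>J. 1 / R * (b j a / f j) * exp (- d j a))"
      unfolding sum_divide_distrib sum_distrib_left by (rule sum_mono)
    also have "\<dots> \<le> F * exp D * (\<Sum>j\<in>J. 1 / R - d j a + (P * v j - N * (x j a)\<^sup>2) / f j)"
      using F0 rs a by (intro mult_left_mono sum_mono) auto
    also have "(\<Sum>j\<in>J. 1 / R - d j a + (P * v j - N * (x j a)\<^sup>2) / f j) = 1 - D + P * V - N * Q"
      using r3 by (simp add: sum.distrib sum_subtractf diff_divide_distrib D_def V_def Q_def
          sum_distrib_left R_def r_def)
    also have "F * exp D * (1 - D + P * V - N * Q) = F * (exp D * (1 + (P * V - D)) - exp D * (N * Q))"
      by (simp add: algebra_simps)
    also have "\<dots> \<le> F * (exp (P * V) - 7/10 * (N * Q))"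
    proof (intro mult_left_mono diff_mono)
      have "exp D * (1 + (P * V - D)) \<le> exp D * exp (P * V - D)"
        by (intro mult_left_mono exp_ge_add_one_self) auto
      then show "exp D * (1 + (P * V - D)) \<le> exp (P * V)" by (simp add: exp_diff)
      \<comment> \<open>Each of the \<open>R\<close> rows contributes at least
        \<open>- 12 / (35 * R)\<close>. The resulting lower bound on \<open>exp D\<close> is the
        7/10 of \<open>row_loss_step\<close>.\<close>
      have "(\<Sum>j\<in>J. - (12 / (35 * R))) \<le> D"
        unfolding D_def by (rule sum_mono) (use dl a in auto)
      then have "D \<ge> - (12/35)" using r3 by (simp add: R_def r_def)
      then have "exp D \<ge> exp (- (12/35))" by simp
      moreover have "exp (12/35 :: real) \<le> 1 + 12/35 + (3/5) * (12/35)\<^sup>2 + 1/70"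
      proof -
        \<comment> \<open>\<open>exp_le_quadratic\<close> stops at 1/3, hence the splitting 12/35 =
          1/3 + 1/105.\<close>
        have "exp (12/35 :: real) = exp (1/3) * exp (1/105)" by (simp flip: exp_add)
        also have "\<dots> \<le> (1 + 1/3 + 3/5 * (1/3)\<^sup>2) * (1 + 1/105 + 3/5 * (1/105)\<^sup>2)"
          by (intro mult_mono exp_le_quadratic) auto
        also have "\<dots> \<le> 1 + 12/35 + (3/5) * (12/35)\<^sup>2 + 1/70" by (simp add: power2_eq_square)
        finally show ?thesis .
      qed
      then have "exp (12/35 :: real) \<le> 10/7" by (simp add: power2_eq_square)
      then have "exp (- (12/35) :: real) \<ge> 7/10"
        by (simp add: exp_minus field_simps)
      ultimately have "7/10 \<le> exp D" by linarith
      then show "7/10 * (N * Q) \<le> exp D * (N * Q)"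
        using gs(3) Q0 by (intro mult_right_mono) auto
    qed (use F0 in auto)
    finally show ?thesis by (simp add: Q_def mult.assoc)
  qed
  \<comment> \<open>Averaged over the column, squared deviations become variances, so gain and loss
    are multiples of the same \<open>V\<close>.\<close>
  have avQ: "avg C (\<lambda>a. \<Sum>j\<in>J. (x j a)\<^sup>2 / f j) = V"
  proof -
    have "avg C (\<lambda>a. (x j a)\<^sup>2 / f j) = v j / f j" for j
      using avg_cmult[of C "1 / f j" "\<lambda>a. (x j a)\<^sup>2"] by (simp add: x_def v_def m_def var_def)
    then show ?thesis by (simp add: avg_sum V_def)
  qed
  have exV: "exp (P * V) \<le> 1 + 7/10 * N * V"
  proof (cases "P \<le> 0")
    case True
    then have "P * V \<le> 0" using V0 by (simp add: mult_nonpos_nonneg)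
    then have "exp (P * V) \<le> 1" by simp
    moreover have "0 \<le> 7/10 * N * V" using gs(3) V0 by simp
    ultimately show ?thesis by linarith
  next
    case False
    then have PN: "101/100 * P \<le> 7/10 * N" using gs(4) by simp
    have cx0: "cx / R \<ge> 0" using e0 r3 by (simp add: cx_def)
    have "g' * e \<le> 2/3 * e" using gs(1) e0 by simp
    then have "P \<le> 2/3 * e" using PN False cx0 by (simp add: N_def)
    have "V \<le> (\<Sum>j\<in>J. 1/49)" unfolding V_def
    proof (rule sum_mono)
      fix j assume "j \<in> J"
      then have "v j / f j \<le> v j / 1" using f1[of j] v0[of j] by (intro divide_left_mono) auto
      then show "v j / f j \<le> 1/49" using v1[OF \<open>j \<in> J\<close>] by linarith
    qed
    then have "V \<le> R / 49" by (simp add: R_def r_def)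
    then have "P * V \<le> P * (R / 49)" using False by (intro mult_left_mono) auto
    also have "\<dots> \<le> 7/10 * (2/3 * e) * (R / 49)"
    proof -
      have "P \<le> 7/10 * (2/3 * e)"
        using PN False cx0 \<open>g' * e \<le> 2/3 * e\<close> by (simp add: N_def)
      then show "P * (R/49) \<le> 7/10 * (2/3 * e) * (R / 49)"
        using r3 by (intro mult_right_mono) auto
    qed
    also have "7/10 * (2/3 * e) * (R / 49) \<le> 1/60"
      using r3 by (simp add: e_def field_simps)
    finally have small: "P * V \<le> 1/60" by simp
    have PV0: "0 \<le> P * V" using False V0 by simp
    have "exp (P * V) \<le> 1 + P * V + 3/5 * (P * V)\<^sup>2"
      using small by (intro exp_le_quadratic) auto
    \<comment> \<open>\<open>3/5 * (1/60) = 1/100\<close> is the origin of the 101/100 in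
      \<open>row_loss_step\<close>.\<close>
    also have "(P * V)\<^sup>2 \<le> 1/60 * (P * V)"
      unfolding power2_eq_square by (rule mult_right_mono[OF small PV0])
    finally have "exp (P * V) \<le> 1 + 101/100 * P * V" by simp
    also have "101/100 * P * V \<le> 7/10 * N * V" using PN V0 by (intro mult_right_mono) auto
    finally show ?thesis by simp
  qed
  have "avg J (\<lambda>j. avg C (\<lambda>a. b j a *
      (\<Prod>l\<in>J - {j}. avg (C - {a}) (b l) + row_loss (card J - 1) * var (C - {a}) (b l))))
    = avg C (\<lambda>a. avg J (\<lambda>j. b j a *
      (\<Prod>l\<in>J - {j}. avg (C - {a}) (b l) + g' * var (C - {a}) (b l))))"
    by (subst avg_swap) (simp add: g'_def r_def)
  also have "\<dots> \<le> avg C (\<lambda>a. F * (exp (P * V) - 7/10 * N * (\<Sum>j\<in>J. (x j a)\<^sup>2 / f j)))"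
  proof (rule avg_mono)
    fix a assume a: "a \<in> C"
    have "avg J (\<lambda>j. b j a * (\<Prod>l\<in>J - {j}. avg (C - {a}) (b l) + g' * var (C - {a}) (b l)))
        = (\<Sum>j\<in>J. b j a * (\<Prod>l\<in>J - {j}. f l * (1 + d l a))) / R"
      unfolding avg_def[of J] R_def r_def
      by (intro arg_cong2[of _ _ _ _ "(/)"] sum.cong prod.cong arg_cong2[of _ _ _ _ "(*)"] sub refl) (use a in auto)
    then show "avg J (\<lambda>j. b j a * (\<Prod>l\<in>J - {j}. avg (C - {a}) (b l) + g' * var (C - {a}) (b l)))
        \<le> F * (exp (P * V) - 7/10 * N * (\<Sum>j\<in>J. (x j a)\<^sup>2 / f j))"
      using col[OF a] by simp
  qed
  also have "\<dots> = F * (exp (P * V) - 7/10 * N * V)"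
    by (simp only: avg_cmult avg_diff avQ avg_const[OF fin(2) ne(2)])
  also have "\<dots> \<le> F * 1" using exV F0 by (intro mult_left_mono) auto
  finally show ?thesis by (simp add: F_def f_def m_def v_def g_def r_def)
qed

text \<open>Induction on the number of rows. Expanding along one row \<open>j\<close> and applying
  the hypothesis to the remaining rows and columns gives a bound for every \<open>j\<close>, hence
  for the average over \<open>j\<close>; only in this average do the first-order terms cancel, which
  is what \<open>permanent_step\<close> exploits.\<close>

theorem permanent_bound:
  assumes "finite J" "finite C" "card J = card C"
    and "\<And>j a. j \<in> J \<Longrightarrow> a \<in> C \<Longrightarrow> 1 \<le> b j a \<and> b j a \<le> 9/7"
  shows "avg (bijs J C) (\<lambda>f. \<Prod>j\<in>J. b j (f j))
    \<le> (\<Prod>j\<in>J. avg C (b j) + row_loss (card J) * var C (b j))"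
  using assms
proof (induction "card J" arbitrary: J C rule: less_induct)
  case less
  note fin = less.prems(1,2) and card = less.prems(3) and b = less.prems(4)
  have step: "avg (bijs J C) (\<lambda>f. \<Prod>j\<in>J. b j (f j))
      \<le> avg C (\<lambda>a. b j a * (\<Prod>l\<in>J - {j}. avg (C - {a}) (b l) + row_loss (card J - 1) * var (C - {a}) (b l)))"
    if j: "j \<in> J" for j
    unfolding avg_bijs[OF j fin card]
  proof (rule avg_mono)
    fix a assume a: "a \<in> C"
    have "avg (bijs (J - {j}) (C - {a})) (\<lambda>f. \<Prod>l\<in>J. b l ((f(j := a)) l))
        = avg (bijs (J - {j}) (C - {a})) (\<lambda>f. b j a * (\<Prod>l\<in>J - {j}. b l (f l)))"
      by (rule avg_cong) (use fin j in \<open>auto simp: prod.remove[of J j] intro!: prod.cong\<close>)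
    also have "\<dots> = b j a * avg (bijs (J - {j}) (C - {a})) (\<lambda>f. \<Prod>l\<in>J - {j}. b l (f l))"
      by (rule avg_cmult)
    also have "\<dots> \<le> b j a * (\<Prod>l\<in>J - {j}. avg (C - {a}) (b l) + row_loss (card (J - {j})) * var (C - {a}) (b l))"
    proof (rule mult_left_mono)
      have "card (J - {j}) < card J" using j fin by (meson card_Diff1_less)
      then show "avg (bijs (J - {j}) (C - {a})) (\<lambda>f. \<Prod>l\<in>J - {j}. b l (f l))
          \<le> (\<Prod>l\<in>J - {j}. avg (C - {a}) (b l) + row_loss (card (J - {j})) * var (C - {a}) (b l))"
        by (rule less.hyps) (use fin j a card b in auto)
    qed (use b[OF j a] in simp)
    finally show "avg (bijs (J - {j}) (C - {a})) (\<lambda>f. \<Prod>l\<in>J. b l ((f(j := a)) l))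
        \<le> b j a * (\<Prod>l\<in>J - {j}. avg (C - {a}) (b l) + row_loss (card J - 1) * var (C - {a}) (b l))"
      using j by simp
  qed
  consider "card J = 0" | "card J = 1" | "card J = 2" | "card J \<ge> 3" by linarith
  then show ?case
  proof cases
    case 1
    then show ?thesis using fin card by (simp add: bijs_empty avg_def)
  next
    case 2
    then obtain j where J: "J = {j}" using card_1_singletonE by blast
    obtain c where C: "C = {c}" using 2 card card_1_singletonE by metis
    have "avg C (\<lambda>a. b j a * (\<Prod>l\<in>J - {j}. avg (C - {a}) (b l) + row_loss (card J - 1) * var (C - {a}) (b l))) = avg C (b j)"
      by (simp add: J)
    then show ?thesis
      using step[of j] var_nonneg[of C "b j"] row_loss_pos[of "card J"] by (simp add: J add_increasing2)
  next
    case 3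
    obtain i j where J: "J = {i, j}" "i \<noteq> j" using 3 by (meson card_2_iff)
    obtain a c where C: "C = {a, c}" "a \<noteq> c" using 3 card by (metis card_2_iff)
    define u where "u = avg C (b i)"
    define w where "w = avg C (b j)"
    define x where "x = (b i a - b i c) / 2"
    define y where "y = (b j a - b j c) / 2"
    have uw: "u = (b i a + b i c) / 2" "w = (b j a + b j c) / 2" using C by (simp_all add: u_def w_def avg_def)
    have vi: "var C (b i) = x\<^sup>2"
      using C by (simp add: var_def avg_def x_def power2_eq_square field_simps)
    have vj: "var C (b j) = y\<^sup>2"
      using C by (simp add: var_def avg_def y_def power2_eq_square field_simps)
    have [simp]: "{i, j} - {i} = {j}" "{a, c} - {a} = {c}" "{a, c} - {c} = {a}" using J C by auto
    have "avg (bijs J C) (\<lambda>f. \<Prod>j\<in>J. b j (f j)) \<le> (b i a * b j c + b i c * b j a) / 2"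
      using step[of i] J C by (simp add: avg_def var_def)
    \<comment> \<open>The excess \<open>- x * y\<close> is at most \<open>(x^2 + y^2) / 2\<close>,
      so with means at least 1 a loss of 1/2 per unit of variance would do for two rows;
      \<open>row_loss 2 = 3/5\<close> exceeds it.\<close>
    also have "\<dots> = u * w - x * y" by (simp add: uw x_def y_def field_simps)
    also have "\<dots> \<le> (u + 3/5 * x\<^sup>2) * (w + 3/5 * y\<^sup>2)"
    proof -
      have u1: "1 \<le> u" "1 \<le> w"
        using b[of i a] b[of i c] b[of j a] b[of j c] J C by (simp_all add: uw)
      have "(u + 3/5 * x\<^sup>2) * (w + 3/5 * y\<^sup>2) = u * w + 3/5 * (x\<^sup>2 * w + u * y\<^sup>2) + 9/25 * (x\<^sup>2 * y\<^sup>2)"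
        by (simp add: algebra_simps)
      moreover have "x\<^sup>2 * 1 \<le> x\<^sup>2 * w" "1 * y\<^sup>2 \<le> u * y\<^sup>2"
        using u1 by (intro mult_left_mono mult_right_mono; simp)+
      moreover have "- (x * y) \<le> 1/2 * (x\<^sup>2 + y\<^sup>2)"
        using zero_le_power2[of "x + y"] by (simp add: power2_eq_square algebra_simps)
      moreover have "0 \<le> x\<^sup>2 * y\<^sup>2" "0 \<le> x\<^sup>2" "0 \<le> y\<^sup>2" by simp_all
      ultimately show ?thesis by argo
    qed
    finally show ?thesis
      using J 3 by (simp add: row_loss_def u_def[symmetric] w_def[symmetric] vi vj)
  next
    case 4
    have ne: "J \<noteq> {}" using 4 by auto
    have "avg (bijs J C) (\<lambda>f. \<Prod>j\<in>J. b j (f j))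
        \<le> avg J (\<lambda>j. avg C (\<lambda>a. b j a *
            (\<Prod>l\<in>J - {j}. avg (C - {a}) (b l) + row_loss (card J - 1) * var (C - {a}) (b l))))"
      by (rule avg_ge[OF fin(1) ne step])
    also have "\<dots> \<le> (\<Prod>j\<in>J. avg C (b j) + row_loss (card J) * var C (b j))"
      by (rule permanent_step[OF fin card 4 b])
    finally show ?thesis .
  qed
qed

section \<open>Exponential moments of the number of hits\<close>

lemma exp_le_quartic:
  fixes s :: real
  assumes "\<bar>s\<bar> \<le> 1/4"
  shows "exp s \<le> 1 + s + s\<^sup>2 / 2 + s ^ 3 / 6 + s ^ 4 / 16"
proof -
  obtain t where t: "\<bar>t\<bar> \<le> \<bar>s\<bar>" and e: "exp s = (\<Sum>m<4. s ^ m / fact m) + exp t / fact 4 * s ^ 4"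
    using Maclaurin_exp_le[of s 4] by blast
  have e4: "exp s = 1 + s + s\<^sup>2 / 2 + s ^ 3 / 6 + exp t / 24 * s ^ 4"
    unfolding e by (simp add: eval_nat_numeral fact_numeral)
  have "exp t \<le> 1 + t + 3/5 * t\<^sup>2" using t assms by (intro exp_le_quadratic) auto
  moreover have "t\<^sup>2 \<le> (1/4)\<^sup>2" using t assms by (intro power2_le_iff_abs_le[THEN iffD2]) auto
  ultimately have "exp t \<le> 3/2" using t assms by (simp add: power2_eq_square abs_le_iff)
  then have "exp t / 24 * s ^ 4 \<le> 1/16 * s ^ 4" by (intro mult_right_mono) auto
  then show ?thesis using e4 by linarith
qed

lemma exp_le_cubic:
  fixes s :: real
  assumes "\<bar>s\<bar> \<le> 1/4"
  shows "exp s \<le> 1 + s + s\<^sup>2 / 2 + \<bar>s\<bar> ^ 3 / 5"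
proof -
  have "s ^ 3 \<le> \<bar>s\<bar> ^ 3" by (metis abs_ge_self power_abs)
  moreover have "s ^ 4 = \<bar>s\<bar> * \<bar>s\<bar> ^ 3" by (simp add: power_abs eval_nat_numeral abs_mult)
  then have "s ^ 4 \<le> 1/4 * \<bar>s\<bar> ^ 3" using mult_right_mono[OF assms, of "\<bar>s\<bar> ^ 3"] by simp
  moreover have "0 \<le> \<bar>s\<bar> ^ 3" by simp
  ultimately show ?thesis using exp_le_quartic[OF assms] by argo
qed

lemma exp_le_nine_sevenths:
  fixes s :: real
  assumes "\<bar>s\<bar> \<le> 1/4"
  shows "exp s \<le> 9/7"
proof -
  have "exp s \<le> exp (1/4)" using assms by simp
  also have "\<dots> \<le> 9/7"
    using exp_le_quartic[of "1/4"] by (simp add: power2_eq_square eval_nat_numeral)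
  finally show ?thesis .
qed

text \<open>The factor of a row of density \<open>p\<close> is \<open>quad s c p\<close>, which equals 1 at \<open>p = 0\<close> and \<open>exp s\<close> at
  \<open>p = 1\<close>; the curvature \<open>c = curvature s n\<close> is just large enough to pay for the cost \<open>row_loss n\<close>
  (see \<open>row_loss_curvature\<close>).\<close>

definition curvature :: "real \<Rightarrow> nat \<Rightarrow> real" where
  "curvature s r = 21/4 * s\<^sup>2 / sqrt (real r)"

definition quad :: "real \<Rightarrow> real \<Rightarrow> real \<Rightarrow> real" where
  "quad s c p = 1 + (exp s - 1) * p + c * (p * (1 - p))"

lemma curvature_nonneg: "0 \<le> curvature s r"
  by (simp add: curvature_def)

lemma curvature_antimono:
  assumes "0 < r" "r \<le> n"
  shows "curvature s n \<le> curvature s r"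
  unfolding curvature_def using assms by (intro divide_left_mono) auto

text \<open>Here \<open>n \<ge> 3\<close> enters: at \<open>n = 2\<close> and
  \<open>\<bar>s\<bar> = 1/4\<close> the curvature would be too large for \<open>quad_range\<close>.
  The case \<open>n \<le> 2\<close> is settled by \<open>prob_tail_small\<close>.\<close>

lemma curvature_le:
  assumes s: "\<bar>s\<bar> \<le> 1/4" and n: "n \<ge> 3"
  shows "curvature s n \<le> 4/5 * \<bar>s\<bar>"
proof -
  have "17/10 \<le> sqrt 3" by (rule real_le_rsqrt) (simp add: power2_eq_square)
  also have "\<dots> \<le> sqrt (real n)" using n by simp
  finally have q: "17/10 \<le> sqrt (real n)" .
  have "s\<^sup>2 = \<bar>s\<bar> * \<bar>s\<bar>" by (simp add: power2_eq_square)
  also have "\<dots> \<le> \<bar>s\<bar> * (1/4)" using s by (intro mult_left_mono) auto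
  finally have "curvature s n \<le> 21/4 * (\<bar>s\<bar> * (1/4)) / (17/10)"
    unfolding curvature_def using q by (intro frac_le) auto
  then show ?thesis by simp
qed

lemma exp_dist_bounds:
  fixes s :: real
  assumes s: "\<bar>s\<bar> \<le> 1/4"
  shows "4/5 * \<bar>s\<bar> \<le> \<bar>exp s - 1\<bar>"
    and "0 \<le> s \<Longrightarrow> exp s - 1 \<le> 8/7 * s"
    and "s \<le> 0 \<Longrightarrow> 1 - exp s \<le> - s"
proof -
  show "s \<le> 0 \<Longrightarrow> 1 - exp s \<le> - s" using exp_ge_add_one_self[of s] by linarith
  show "exp s - 1 \<le> 8/7 * s" if "0 \<le> s"
  proof -
    have a: "s\<^sup>2 \<le> 1/4 * s" using that s unfolding power2_eq_square by (intro mult_right_mono) auto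
    have b: "s ^ 3 \<le> 1/16 * s"
      using mult_mono[OF a, of s "1/4"] that s by (simp add: power3_eq_cube power2_eq_square)
    have c: "s ^ 4 \<le> 1/64 * s"
      using mult_mono[OF b, of s "1/4"] that s by (simp add: eval_nat_numeral mult.assoc)
    show ?thesis using exp_le_quartic[OF s] a b c that by argo
  qed
  show "4/5 * \<bar>s\<bar> \<le> \<bar>exp s - 1\<bar>"
  proof (cases "0 \<le> s")
    case True
    then have "\<bar>exp s - 1\<bar> = exp s - 1" "\<bar>s\<bar> = s" by auto
    then show ?thesis using exp_ge_add_one_self[of s] True by linarith
  next
    case False
    have "s ^ 3 / 6 + s ^ 4 / 16 = s ^ 3 * (1/6 + s / 16)" by (simp add: eval_nat_numeral algebra_simps)
    also have "\<dots> \<le> 0" using False s by (intro mult_nonpos_nonneg) (auto simp: power_le_zero_eq)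
    finally have "exp s \<le> 1 + s + s\<^sup>2 / 2" using exp_le_quartic[OF s] by linarith
    moreover have "s\<^sup>2 \<le> 1/4 * - s"
      using False s mult_right_mono[of "- s" "1/4" "- s"] by (simp add: power2_eq_square abs_if)
    ultimately show ?thesis using False by (simp add: abs_if)
  qed
qed

lemma row_loss_le: "r > 0 \<Longrightarrow> row_loss r \<le> 4 / (4 + sqrt (real r))"
proof -
  assume "r > 0"
  have "sqrt 3 \<le> (2::real)" by (rule real_le_lsqrt) auto
  moreover have "sqrt 2 \<le> (2::real)" by (rule real_le_lsqrt) auto
  moreover have "r = 1 \<or> r = 2 \<or> r = 3 \<or> \<not> r \<le> 2 \<and> r \<noteq> 3" using \<open>r > 0\<close> by linarith
  moreover have "c \<le> 4 / (4 + x)" if "0 \<le> x" "c * (4 + x) \<le> 4" for c x :: real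
    using that by (simp add: pos_le_divide_eq)
  note this[of "sqrt (real r)" "row_loss r"]
  ultimately show ?thesis by (auto simp: row_loss_def)
qed

text \<open>The condition for the curvature to pay for the loss: factors normalised by
  \<open>min 1 (exp s)\<close> have Lipschitz constant
  \<open>(\<bar>exp s - 1\<bar> + curvature s n) / min 1 (exp s)\<close>, and one normalising factor
  is multiplied back. The curvature on the left is harmless, since it is at most
  \<open>4/5 * \<bar>s\<bar>\<close> and enters squared.\<close>

lemma row_loss_curvature:
  assumes s: "\<bar>s\<bar> \<le> 1/4" and n: "n \<ge> 3" and r: "0 < r" "r \<le> n"
  shows "row_loss r * (\<bar>exp s - 1\<bar> + curvature s n)\<^sup>2 / min 1 (exp s) \<le> curvature s r"
proof -
  define t where "t = \<bar>s\<bar>"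
  define b where "b = curvature s n"
  have t: "0 \<le> t" "t \<le> 1/4" using s by (simp_all add: t_def)
  have b0: "0 \<le> b" by (simp add: b_def curvature_nonneg)
  have 1: "(\<bar>exp s - 1\<bar> + b)\<^sup>2 / min 1 (exp s) \<le> 64/49 * (t + b)\<^sup>2"
  proof (cases "0 \<le> s")
    case True
    have "\<bar>exp s - 1\<bar> + b \<le> 8/7 * (t + b)"
      using exp_dist_bounds(2)[OF s True] True b0 by (simp add: t_def)
    then have "(\<bar>exp s - 1\<bar> + b)\<^sup>2 \<le> (8/7 * (t + b))\<^sup>2" using b0 by (intro power_mono) auto
    also have "\<dots> = 64/49 * (t + b)\<^sup>2" by (simp only: power_mult_distrib) (simp add: power2_eq_square)
    finally show ?thesis using True by simp
  next
    case False
    have "\<bar>exp s - 1\<bar> + b \<le> t + b"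
      using exp_dist_bounds(3)[OF s] False by (simp add: t_def abs_if)
    then have "(\<bar>exp s - 1\<bar> + b)\<^sup>2 \<le> (t + b)\<^sup>2" using b0 by (intro power_mono) auto
    moreover have "7/9 \<le> exp s"
      using exp_le_nine_sevenths[of "- s"] s by (simp add: exp_minus field_simps)
    moreover have "min 1 (exp s) = exp s" using False by simp
    ultimately have "(\<bar>exp s - 1\<bar> + b)\<^sup>2 / min 1 (exp s) \<le> (t + b)\<^sup>2 / (7/9)"
      by (intro frac_le) auto
    also have "\<dots> \<le> 64/49 * (t + b)\<^sup>2" by simp
    finally show ?thesis .
  qed
  have g0: "row_loss r > 0" by (rule row_loss_pos)
  have "row_loss r * (\<bar>exp s - 1\<bar> + b)\<^sup>2 / min 1 (exp s) \<le> row_loss r * (64/49 * (t + b)\<^sup>2)"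
    using mult_left_mono[OF 1, of "row_loss r"] g0 by simp
  also have "\<dots> \<le> curvature s r"
  proof (cases "r = 1")
    case True
    have "t + b \<le> 9/5 * t" using curvature_le[OF s n] by (simp add: t_def b_def)
    then have "(t + b)\<^sup>2 \<le> (9/5 * t)\<^sup>2" using t b0 by (intro power_mono) auto
    then have "row_loss r * (64/49 * (t + b)\<^sup>2) \<le> 3/5 * (64/49 * (81/25 * t\<^sup>2))"
      using True by (simp add: row_loss_def power2_eq_square)
    also have "\<dots> \<le> 21/4 * t\<^sup>2" by simp
    finally show ?thesis using True by (simp add: curvature_def t_def)
  next
    case False
    define q where "q = sqrt (real r)"
    have "5/4 \<le> sqrt 2" by (rule real_le_rsqrt) (simp add: power2_eq_square)
    also have "\<dots> \<le> q" using False r by (simp add: q_def)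
    finally have q: "5/4 \<le> q" .
    have "b \<le> curvature s r" unfolding b_def by (rule curvature_antimono) (use r in auto)
    also have "\<dots> = 21/4 * (t * t) / q" by (simp add: curvature_def q_def t_def power2_eq_square)
    also have "\<dots> \<le> 21/4 * (t * (1/4)) / q"
      using t q by (intro divide_right_mono mult_left_mono) auto
    finally have "t + b \<le> t * (1 + 21/16 / q)" by (simp add: algebra_simps)
    then have "(t + b)\<^sup>2 \<le> (t * (1 + 21/16 / q))\<^sup>2" using t b0 by (intro power_mono) auto
    then have "row_loss r * (64/49 * (t + b)\<^sup>2) \<le> 4 / (4 + q) * (64/49 * (t * (1 + 21/16 / q))\<^sup>2)"
      using row_loss_le[OF r(1)] q unfolding q_def[symmetric] by (intro mult_mono) auto
    also have "\<dots> = t\<^sup>2 * (4 * (64/49 * (1 + 21/16 / q)\<^sup>2) / (4 + q))"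
      by (simp add: power_mult_distrib mult_ac)
    also have "\<dots> \<le> t\<^sup>2 * (21/4 / q)"
    proof (rule mult_left_mono)
      \<comment> \<open>The leading coefficients 256/49 and 21/4 explain the constant in
        \<open>curvature\<close>. At \<open>q = 1\<close> the estimate would fail, hence the
        separate case \<open>r = 1\<close>, where \<open>row_loss 1 = 3/5\<close> is below the
        general formula.\<close>
      have "q * (4 * (64/49 * (1 + 21/16 / q)\<^sup>2)) = 256/49 * q + 96/7 + 9 / q"
        using q by (simp add: power2_eq_square field_simps)
      also have "\<dots> \<le> 21/4 * (4 + q)"
      proof -
        have "9 / q \<le> 9 / (5/4)" using q by (intro divide_left_mono) auto
        then show ?thesis using q by simp
      qed
      finally have "4 * (64/49 * (1 + 21/16 / q)\<^sup>2) \<le> 21/4 * (4 + q) / q"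
        using q by (simp add: pos_le_divide_eq mult.commute)
      also have "21/4 * (4 + q) / q = 21/4 / q * (4 + q)" by simp
      finally show "4 * (64/49 * (1 + 21/16 / q)\<^sup>2) / (4 + q) \<le> 21/4 / q"
        using q by (intro pos_divide_le_eq[THEN iffD2]) auto
    qed simp
    also have "\<dots> = curvature s r" by (simp add: curvature_def q_def t_def)
    finally show ?thesis .
  qed
  finally show ?thesis by (simp add: b_def)
qed

text \<open>Since \<open>c \<le> \<bar>exp s - 1\<bar>\<close>, the quadratic is monotone in
  \<open>p\<close> and stays between its end values 1 and \<open>exp s\<close>, whose ratio is at
  most 9/7 in either order.\<close>

lemma quad_range:
  assumes s: "\<bar>s\<bar> \<le> 1/4" and c: "0 \<le> c" "c \<le> 4/5 * \<bar>s\<bar>" and p: "0 \<le> p" "p \<le> 1"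
  shows "min 1 (exp s) \<le> quad s c p" "quad s c p \<le> 9/7 * min 1 (exp s)"
proof -
  define z where "z = exp s - 1"
  have cz: "c \<le> \<bar>z\<bar>" using exp_dist_bounds(1)[OF s] c by (simp add: z_def)
  have cp: "0 \<le> c * (p * (1 - p))" using c p by simp
  have q: "quad s c p = 1 + z * p + c * (p * (1 - p))" by (simp add: quad_def z_def)
  have cp1: "c * p \<le> c" using c p by (simp add: mult_left_le)
  have "min 1 (exp s) \<le> quad s c p \<and> quad s c p \<le> 9/7 * min 1 (exp s)"
  proof (cases "0 \<le> s")
    case True
    then have z: "z \<ge> 0" by (simp add: z_def)
    have "c * p * (1 - p) \<le> z * (1 - p)" using cp1 cz z p by (intro mult_right_mono) auto
    then have "quad s c p \<le> 1 + z" by (simp add: q algebra_simps)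
    moreover have "1 \<le> quad s c p" using z p cp by (simp add: q)
    ultimately show ?thesis using True exp_le_nine_sevenths[OF s] by (simp add: z_def)
  next
    case False
    then have z: "z \<le> 0" "\<bar>z\<bar> = - z" by (simp_all add: z_def)
    have "c * (1 - p) \<le> - z" using mult_left_mono[of "1 - p" 1 c] c p cz z by simp
    then have "c * (1 - p) * p \<le> - z * p" using p by (intro mult_right_mono) auto
    then have "quad s c p \<le> 1" by (simp add: q algebra_simps)
    moreover have "z * 1 \<le> z * p" using z p by (intro mult_left_mono_neg) auto
    then have "exp s \<le> quad s c p" using cp by (simp add: q z_def)
    moreover have "1 \<le> 9/7 * exp s"
      using exp_le_nine_sevenths[of "- s"] s by (simp add: exp_minus field_simps)
    ultimately show ?thesis using False by simp
  qed
  then show "min 1 (exp s) \<le> quad s c p" "quad s c p \<le> 9/7 * min 1 (exp s)" by auto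
qed

lemma quad_lipschitz:
  assumes "0 \<le> c" "0 \<le> p" "p \<le> 1" "0 \<le> p'" "p' \<le> 1"
  shows "\<bar>quad s c p - quad s c p'\<bar> \<le> (\<bar>exp s - 1\<bar> + c) * \<bar>p - p'\<bar>"
proof -
  have "quad s c p - quad s c p' = ((exp s - 1) + c * (1 - p - p')) * (p - p')"
    by (simp add: quad_def algebra_simps)
  moreover have "\<bar>(exp s - 1) + c * (1 - p - p')\<bar> \<le> \<bar>exp s - 1\<bar> + c"
  proof -
    have "\<bar>c * (1 - p - p')\<bar> \<le> c * 1" unfolding abs_mult using assms by (intro mult_mono) auto
    then show ?thesis by linarith
  qed
  ultimately show ?thesis by (simp add: abs_mult mult_right_mono)
qed

text \<open>Only the term \<open>- c * p^2\<close> sees more of the distribution than its mean; the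
  variance it produces is the gain that pays for \<open>row_loss\<close>.\<close>

lemma avg_quad:
  assumes "finite C" "C \<noteq> {}"
  shows "avg C (\<lambda>a. quad s c (f a)) = quad s c (avg C f) - c * var C f"
proof -
  have "avg C (\<lambda>a. quad s c (f a)) = avg C (\<lambda>a. 1 + ((exp s - 1 + c) * f a - c * (f a)\<^sup>2))"
    by (rule avg_cong) (auto simp: quad_def power2_eq_square algebra_simps)
  also have "\<dots> = 1 + ((exp s - 1 + c) * avg C f - c * (var C f + (avg C f)\<^sup>2))"
    by (simp only: avg_add avg_diff avg_cmult avg_const[OF assms] avg_square[OF assms])
  finally show ?thesis by (simp add: quad_def power2_eq_square algebra_simps)
qed

lemma avg_in_unit:
  assumes "finite C" "C \<noteq> {}" "\<And>a. a \<in> C \<Longrightarrow> 0 \<le> f a \<and> f a \<le> 1"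
  shows "0 \<le> avg C f" "avg C f \<le> 1"
  using avg_ge[of C 0 f] avg_le[of C f 1] assms by auto

text \<open>Division by \<open>l = min 1 (exp s)\<close> brings the factors into the range of
  \<open>permanent_bound\<close>. In each row the bijection costs at most
  \<open>curvature s (card J)\<close> times the variance and concavity returns
  \<open>curvature s n\<close> times it; for \<open>card J = n\<close> the two cancel.\<close>

lemma quad_stage:
  assumes s: "\<bar>s\<bar> \<le> 1/4" and n: "n \<ge> 3"
    and fin: "finite J" "finite C" and card: "card J = card C" "card J \<le> n"
    and A: "\<And>j a. j \<in> J \<Longrightarrow> a \<in> C \<Longrightarrow> 0 \<le> A j a \<and> A j a \<le> 1"
  shows "avg (bijs J C) (\<lambda>f. \<Prod>j\<in>J. quad s (curvature s n) (A j (f j)))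
    \<le> (\<Prod>j\<in>J. quad s (curvature s n) (avg C (A j)) + (curvature s (card J) - curvature s n) * var C (A j))"
proof -
  define l where "l = min 1 (exp s)"
  define c where "c = curvature s n"
  define r where "r = card J"
  have l0: "l > 0" by (simp add: l_def)
  have c: "0 \<le> c" "c \<le> 4/5 * \<bar>s\<bar>" using curvature_nonneg curvature_le[OF s n] by (simp_all add: c_def)
  define b where "b = (\<lambda>j a. quad s c (A j a) / l)"
  have b: "1 \<le> b j a \<and> b j a \<le> 9/7" if "j \<in> J" "a \<in> C" for j a
    using quad_range[OF s c, of "A j a"] A[OF that] l0 by (simp add: b_def l_def[symmetric] field_simps)
  have "avg (bijs J C) (\<lambda>f. \<Prod>j\<in>J. quad s c (A j (f j)))
      = avg (bijs J C) (\<lambda>f. l ^ r * (\<Prod>j\<in>J. b j (f j)))"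
    using l0 by (intro avg_cong refl) (simp add: b_def prod_dividef r_def)
  also have "\<dots> = l ^ r * avg (bijs J C) (\<lambda>f. \<Prod>j\<in>J. b j (f j))" by (rule avg_cmult)
  also have "\<dots> \<le> l ^ r * (\<Prod>j\<in>J. avg C (b j) + row_loss r * var C (b j))"
    using l0 permanent_bound[OF fin card(1) b] by (intro mult_left_mono) (auto simp: r_def)
  also have "\<dots> = (\<Prod>j\<in>J. l * (avg C (b j) + row_loss r * var C (b j)))"
    by (simp add: prod.distrib r_def)
  also have "\<dots> \<le> (\<Prod>j\<in>J. quad s c (avg C (A j)) + (curvature s r - c) * var C (A j))"
  proof (rule prod_mono, intro conjI)
    fix j assume j: "j \<in> J"
    have ne: "C \<noteq> {}" using j fin card by auto
    have r: "0 < r" "r \<le> n" using j fin card by (auto simp: r_def card_gt_0_iff)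
    have bavg: "avg C (b j) = avg C (\<lambda>a. quad s c (A j a)) / l"
      using avg_cmult[of C "1 / l" "\<lambda>a. quad s c (A j a)"] by (simp add: b_def)
    have "1 \<le> avg C (b j)" using b[OF j] fin ne by (intro avg_ge) auto
    then show "0 \<le> l * (avg C (b j) + row_loss r * var C (b j))"
      using l0 row_loss_pos[of r] var_nonneg[of C "b j"] by simp
    have "var C (b j) \<le> ((\<bar>exp s - 1\<bar> + c) / l)\<^sup>2 * var C (A j)"
      unfolding b_def
    proof (rule var_lipschitz[where h = "\<lambda>p. quad s c p / l", OF fin(2) ne])
      fix a assume a: "a \<in> C"
      have "\<bar>quad s c (A j a) - quad s c (avg C (A j))\<bar> \<le> (\<bar>exp s - 1\<bar> + c) * \<bar>A j a - avg C (A j)\<bar>"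
        using A[OF j] a avg_in_unit[OF fin(2) ne, of "A j"] c(1) by (intro quad_lipschitz) auto
      then show "\<bar>quad s c (A j a) / l - quad s c (avg C (A j)) / l\<bar> \<le> (\<bar>exp s - 1\<bar> + c) / l * \<bar>A j a - avg C (A j)\<bar>"
        using l0 by (simp add: diff_divide_distrib[symmetric] divide_right_mono)
    qed
    then have "l * (row_loss r * var C (b j)) \<le> l * (row_loss r * (((\<bar>exp s - 1\<bar> + c) / l)\<^sup>2 * var C (A j)))"
      using l0 row_loss_pos[of r] by (intro mult_left_mono) auto
    also have "\<dots> = row_loss r * (\<bar>exp s - 1\<bar> + c)\<^sup>2 / l * var C (A j)"
      using l0 by (simp add: power2_eq_square)
    also have "\<dots> \<le> curvature s r * var C (A j)"
      using row_loss_curvature[OF s n r] var_nonneg by (intro mult_right_mono) (auto simp: l_def c_def)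
    finally have "l * (row_loss r * var C (b j)) \<le> curvature s r * var C (A j)" .
    moreover have "l * avg C (b j) = quad s c (avg C (A j)) - c * var C (A j)"
      using l0 by (simp add: bavg avg_quad[OF fin(2) ne])
    ultimately show "l * (avg C (b j) + row_loss r * var C (b j)) \<le> quad s c (avg C (A j)) + (curvature s r - c) * var C (A j)"
      by (simp add: distrib_left left_diff_distrib)
  qed
  finally show ?thesis by (simp add: c_def r_def)
qed

text \<open>A random matching is generated one coordinate at a time: \<open>hit_expectation n d g \<phi>\<close> is the expectation of
  \<open>\<phi>\<close> applied to the number of hits when \<open>d\<close> coordinates are still to be drawn and \<open>g j\<close> is the
  indicator, on the remaining \<open>d\<close> entries, that row \<open>j\<close> hits.\<close>

primrec hit_expectation :: "nat \<Rightarrow> nat \<Rightarrow> (nat \<Rightarrow> nat list \<Rightarrow> real) \<Rightarrow> (real \<Rightarrow> real) \<Rightarrow> real" where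
  "hit_expectation n 0 g \<phi> = \<phi> (\<Sum>j<n. g j [])"
| "hit_expectation n (Suc d) g \<phi> = avg (bijs {..<n} {1..n}) (\<lambda>f. hit_expectation n d (\<lambda>j l. g j (f j # l)) \<phi>)"

text \<open>Within one row the entries come from different bijections, so they are independent and
  uniform on \<open>{1..n}\<close>.\<close>

primrec hit_density :: "nat \<Rightarrow> nat \<Rightarrow> (nat list \<Rightarrow> real) \<Rightarrow> real" where
  "hit_density n 0 g = g []"
| "hit_density n (Suc d) g = avg {1..n} (\<lambda>a. hit_density n d (\<lambda>l. g (a # l)))"

lemma hit_density_unit:
  assumes "n > 0" "\<And>l. g l \<in> {0, 1}"
  shows "0 \<le> hit_density n d g \<and> hit_density n d g \<le> 1"
  using assms(2)
proof (induction d arbitrary: g)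
  case 0
  show ?case using 0[of "[]"] by (cases "g [] = 0") simp_all
next
  case (Suc d)
  have "0 \<le> hit_density n d (\<lambda>l. g (a # l)) \<and> hit_density n d (\<lambda>l. g (a # l)) \<le> 1" for a
    by (rule Suc.IH) (rule Suc.prems)
  then show ?case using avg_in_unit[of "{1..n}"] assms(1) by simp
qed

lemma hit_expectation_mono: "(\<And>y. \<phi> y \<le> \<psi> y) \<Longrightarrow> hit_expectation n d g \<phi> \<le> hit_expectation n d g \<psi>"
  by (induction d arbitrary: g) (auto intro: avg_mono)

lemma hit_expectation_cmult: "hit_expectation n d g (\<lambda>y. c * \<phi> y) = c * hit_expectation n d g \<phi>"
  by (induction d arbitrary: g) (auto simp: avg_cmult)

text \<open>Every stage involves all \<open>n\<close> rows, so the variance term of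
  \<open>quad_stage\<close> has coefficient 0 and no error accumulates with the number of
  coordinates.\<close>

lemma hit_expectation_exp:
  assumes s: "\<bar>s\<bar> \<le> 1/4" and n: "n \<ge> 3" and g: "\<And>j l. g j l \<in> {0, 1}"
  shows "hit_expectation n d g (\<lambda>y. exp (s * y)) \<le> (\<Prod>j<n. quad s (curvature s n) (hit_density n d (g j)))"
  using g
proof (induction d arbitrary: g)
  case 0
  have "exp (s * g j []) = quad s (curvature s n) (g j [])" for j
    using 0[of j "[]"] by (auto simp: quad_def)
  then show ?case by (simp add: sum_distrib_left exp_sum)
next
  case (Suc d)
  have "hit_expectation n (Suc d) g (\<lambda>y. exp (s * y))
      \<le> avg (bijs {..<n} {1..n}) (\<lambda>f. \<Prod>j<n. quad s (curvature s n) (hit_density n d (\<lambda>l. g j (f j # l))))"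
    using Suc by (auto intro!: avg_mono)
  also have "\<dots> \<le> (\<Prod>j<n. quad s (curvature s n) (avg {1..n} (\<lambda>a. hit_density n d (\<lambda>l. g j (a # l))))
      + (curvature s (card {..<n}) - curvature s n) * var {1..n} (\<lambda>a. hit_density n d (\<lambda>l. g j (a # l))))"
    by (rule quad_stage[OF s n, where A = "\<lambda>j a. hit_density n d (\<lambda>l. g j (a # l))"])
      (use n Suc.prems in \<open>auto intro!: hit_density_unit[THEN conjunct1] hit_density_unit[THEN conjunct2]\<close>)
  finally show ?case by simp
qed

text \<open>The state in the middle of a coordinate: the rows in \<open>J\<close> still have to be matched with the values
  in \<open>C\<close>, the other rows \<open>j\<close> have received \<open>f j\<close>.\<close>

definition partial_hit_expectation :: "nat \<Rightarrow> nat \<Rightarrow> (nat \<Rightarrow> nat list \<Rightarrow> real) \<Rightarrow> nat set \<Rightarrow> nat set \<Rightarrow> (nat \<Rightarrow> nat) \<Rightarrow> (real \<Rightarrow> real) \<Rightarrow> real" where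
  "partial_hit_expectation n d g J C f \<phi> = avg (bijs J C) (\<lambda>\<sigma>. hit_expectation n d (\<lambda>j l. g j ((if j \<in> J then \<sigma> j else f j) # l)) \<phi>)"

definition row_mean :: "nat \<Rightarrow> nat \<Rightarrow> (nat \<Rightarrow> nat list \<Rightarrow> real) \<Rightarrow> nat set \<Rightarrow> nat set \<Rightarrow> (nat \<Rightarrow> nat) \<Rightarrow> nat \<Rightarrow> real" where
  "row_mean n d g J C f j = (if j \<in> J then avg C (\<lambda>a. hit_density n d (\<lambda>l. g j (a # l))) else hit_density n d (\<lambda>l. g j (f j # l)))"

text \<open>Rows outside \<open>J\<close> are fixed and factor out. Coordinates still to come are
  complete stages and leave no error; only the partly revealed one contributes variances.\<close>

lemma partial_hit_expectation_exp:
  assumes s: "\<bar>s\<bar> \<le> 1/4" and n: "n \<ge> 3" and g: "\<And>j l. g j l \<in> {0, 1}"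
    and J: "J \<subseteq> {..<n}" and C: "finite C" "card J = card C"
  shows "partial_hit_expectation n d g J C f (\<lambda>y. exp (s * y))
    \<le> (\<Prod>j<n. quad s (curvature s n) (row_mean n d g J C f j)
        + (if j \<in> J then (curvature s (card J) - curvature s n) * var C (\<lambda>a. hit_density n d (\<lambda>l. g j (a # l))) else 0))"
proof -
  define A where "A = (\<lambda>j a. hit_density n d (\<lambda>l. g j (a # l)))"
  define c where "c = curvature s n"
  have A: "0 \<le> A j a \<and> A j a \<le> 1" for j a
    unfolding A_def by (rule hit_density_unit) (use n g in auto)
  have finJ: "finite J" using J finite_subset by blast
  have c: "0 \<le> c" "c \<le> 4/5 * \<bar>s\<bar>" using curvature_nonneg curvature_le[OF s n] by (simp_all add: c_def)
  have q0: "0 \<le> quad s c (A j a)" for j a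
    using quad_range(1)[OF s c, of "A j a"] A[of j a] by (auto simp: min_def split: if_splits intro: order_trans[OF exp_ge_zero])
  have split: "(\<Prod>j<n. F j) = (\<Prod>j\<in>{..<n} - J. F j) * (\<Prod>j\<in>J. F j)" for F :: "nat \<Rightarrow> real"
    using J by (intro prod.subset_diff) auto
  have "partial_hit_expectation n d g J C f (\<lambda>y. exp (s * y))
      \<le> avg (bijs J C) (\<lambda>\<sigma>. \<Prod>j<n. quad s c (A j (if j \<in> J then \<sigma> j else f j)))"
    unfolding partial_hit_expectation_def A_def c_def by (intro avg_mono hit_expectation_exp[OF s n]) (use g in auto)
  also have "\<dots> = avg (bijs J C) (\<lambda>\<sigma>. (\<Prod>j\<in>{..<n} - J. quad s c (A j (f j))) * (\<Prod>j\<in>J. quad s c (A j (\<sigma> j))))"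
    by (intro avg_cong refl, subst split) (auto intro!: arg_cong2[of _ _ _ _ "(*)"] prod.cong)
  also have "\<dots> = (\<Prod>j\<in>{..<n} - J. quad s c (A j (f j))) * avg (bijs J C) (\<lambda>\<sigma>. \<Prod>j\<in>J. quad s c (A j (\<sigma> j)))"
    by (rule avg_cmult)
  also have "\<dots> \<le> (\<Prod>j\<in>{..<n} - J. quad s c (A j (f j)))
      * (\<Prod>j\<in>J. quad s c (avg C (A j)) + (curvature s (card J) - c) * var C (A j))"
    unfolding c_def
  proof (intro mult_left_mono quad_stage[OF s n finJ C(1,2)] prod_nonneg)
    show "card J \<le> n" using card_mono[OF _ J] by simp
  qed (use A q0 in \<open>auto simp: c_def\<close>)
  also have "\<dots> = (\<Prod>j<n. quad s c (row_mean n d g J C f j)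
        + (if j \<in> J then (curvature s (card J) - c) * var C (A j) else 0))"
    unfolding split[of "\<lambda>j. quad s c (row_mean n d g J C f j) + (if j \<in> J then (curvature s (card J) - c) * var C (A j) else 0)"]
    by (intro arg_cong2[of _ _ _ _ "(*)"] prod.cong) (auto simp: row_mean_def A_def)
  finally show ?thesis by (simp only: c_def A_def)
qed

text \<open>A sum of row variances is at most the mean and at most a quarter of the number of rows;
  the geometric mean of the two bounds brings in the \<open>sqrt N\<close> that cancels the one in
  \<open>curvature\<close>.\<close>

lemma le_half_sqrt_mult:
  fixes u X N :: real
  assumes "0 \<le> u" "u \<le> X" "u \<le> N / 4"
  shows "u \<le> sqrt X * sqrt N / 2"
proof -
  have "u * u \<le> X * (N / 4)" using assms by (intro mult_mono) auto
  then have "u \<le> sqrt (X * N / 4)" using assms by (intro real_le_rsqrt) (simp add: power2_eq_square)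
  also have "\<dots> = sqrt X * sqrt N / 2"
    using real_sqrt_unique[of 2 4] by (simp add: real_sqrt_mult real_sqrt_divide)
  finally show ?thesis .
qed

text \<open>\<open>s^2 / 2 + \<bar>s\<bar>^3 / 5\<close> bounds the Poisson exponent
  \<open>exp s - 1 - s\<close> (see \<open>exp_le_cubic\<close>); the term with
  \<open>sqrt X\<close> is the price of drawing bijections. With a functional \<open>E\<close> in
  place of a measure, mixing conditional laws is just averaging.\<close>

definition subgamma :: "real \<Rightarrow> ((real \<Rightarrow> real) \<Rightarrow> real) \<Rightarrow> bool" where
  "subgamma X E \<longleftrightarrow> 0 \<le> X \<and> (\<forall>s. \<bar>s\<bar> \<le> 1/4 \<longrightarrow>
     E (\<lambda>y. exp (s * (y - X))) \<le> exp ((s\<^sup>2 / 2 + \<bar>s\<bar> ^ 3 / 5) * X + 21/4 * s\<^sup>2 * sqrt X))"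

lemma subgamma_partial_hit_expectation:
  assumes n: "n \<ge> 3" and g: "\<And>j l. g j l \<in> {0, 1}"
    and J: "J \<subseteq> {..<n}" and C: "finite C" "card J = card C"
  shows "subgamma (\<Sum>j<n. row_mean n d g J C f j) (partial_hit_expectation n d g J C f)"
  unfolding subgamma_def
proof (intro conjI allI impI)
  define q where "q = row_mean n d g J C f"
  define X where "X = (\<Sum>j<n. q j)"
  define v where "v = (\<lambda>j. if j \<in> J then var C (\<lambda>a. hit_density n d (\<lambda>l. g j (a # l))) else 0)"
  have finJ: "finite J" using J finite_subset by blast
  have A: "0 \<le> hit_density n d (\<lambda>l. g j (a # l)) \<and> hit_density n d (\<lambda>l. g j (a # l)) \<le> 1" for j a
    by (rule hit_density_unit) (use n g in auto)
  have ne: "C \<noteq> {}" if "j \<in> J" for j using that finJ C by auto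
  have q: "0 \<le> q j \<and> q j \<le> 1" for j
    unfolding q_def row_mean_def using A avg_in_unit[OF C(1) ne] by auto
  have v: "0 \<le> v j \<and> v j \<le> q j * (1 - q j)" for j
    using var_nonneg var_le_mean[OF C(1) ne] A q[of j] by (auto simp: v_def q_def row_mean_def)
  have q4: "q j * (1 - q j) \<le> 1/4" for j
    using zero_le_power2[of "q j - 1/2"] by (simp add: power2_eq_square algebra_simps)
  have q1: "q j * (1 - q j) \<le> q j" for j using q[of j] by (simp add: mult_left_le)
  have X0: "0 \<le> X" unfolding X_def by (rule sum_nonneg) (use q in auto)
  then show "0 \<le> (\<Sum>j<n. row_mean n d g J C f j)" by (simp add: X_def q_def)
  fix s :: real assume s: "\<bar>s\<bar> \<le> 1/4"
  define W where "W = (\<Sum>j<n. q j * (1 - q j))"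
  define V where "V = (\<Sum>j\<in>J. v j)"
  have "partial_hit_expectation n d g J C f (\<lambda>y. exp (s * y))
      \<le> (\<Prod>j<n. quad s (curvature s n) (q j) + (curvature s (card J) - curvature s n) * v j)"
    using partial_hit_expectation_exp[OF s n g J C, where d = d and f = f] by (simp add: q_def v_def if_distrib cong: if_cong)
  also have "\<dots> \<le> (\<Prod>j<n. exp ((exp s - 1) * q j + curvature s n * (q j * (1 - q j)) + curvature s (card J) * v j))"
  proof (rule prod_mono, intro conjI)
    fix j
    have c: "0 \<le> curvature s n" "curvature s n \<le> 4/5 * \<bar>s\<bar>" using curvature_nonneg curvature_le[OF s n] by simp_all
    have "0 \<le> quad s (curvature s n) (q j)"
      using quad_range(1)[OF s c, of "q j"] q[of j] by (auto simp: min_def split: if_splits intro: order_trans[OF exp_ge_zero])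
    moreover have "0 \<le> (curvature s (card J) - curvature s n) * v j"
    proof (cases "j \<in> J")
      case True
      then have "0 < card J" "card J \<le> n" using finJ card_mono[OF _ J] by (auto simp: card_gt_0_iff)
      then show ?thesis using curvature_antimono[of "card J" n s] v[of j] by simp
    qed (simp add: v_def)
    ultimately show "0 \<le> quad s (curvature s n) (q j) + (curvature s (card J) - curvature s n) * v j" by simp
    have "0 \<le> curvature s n * v j" using c v[of j] by simp
    then show "quad s (curvature s n) (q j) + (curvature s (card J) - curvature s n) * v j
        \<le> exp ((exp s - 1) * q j + curvature s n * (q j * (1 - q j)) + curvature s (card J) * v j)"
      using exp_ge_add_one_self[of "(exp s - 1) * q j + curvature s n * (q j * (1 - q j)) + curvature s (card J) * v j"]
      by (simp add: quad_def algebra_simps)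
  qed
  also have "\<dots> = exp ((exp s - 1) * X + curvature s n * W + curvature s (card J) * V)"
  proof -
    have "(\<Sum>j<n. v j) = V"
      unfolding V_def by (rule sum.mono_neutral_right) (use J in \<open>auto simp: v_def\<close>)
    then show ?thesis
      by (simp add: exp_sum[symmetric] sum.distrib sum_distrib_left[symmetric] X_def W_def)
  qed
  finally have 1: "partial_hit_expectation n d g J C f (\<lambda>y. exp (s * y)) \<le> exp ((exp s - 1) * X + curvature s n * W + curvature s (card J) * V)" .
  \<comment> \<open>Used twice: for \<open>W\<close>, the curvature terms of all \<open>n\<close>
    rows, and for \<open>V\<close>, the loss of the rows being revealed; 21/8 + 21/8 = 21/4.\<close>
  have half: "curvature s r * u \<le> 21/8 * s\<^sup>2 * sqrt X" if "0 \<le> u" "u \<le> X" "u \<le> real r / 4" for r u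
  proof (cases "r = 0")
    case True
    then show ?thesis using X0 by (simp add: curvature_def)
  next
    case False
    have "curvature s r * u \<le> curvature s r * (sqrt X * sqrt (real r) / 2)"
      using le_half_sqrt_mult[OF that] by (intro mult_left_mono curvature_nonneg)
    also have "\<dots> = 21/8 * s\<^sup>2 * sqrt X" using False by (simp add: curvature_def)
    finally show ?thesis .
  qed
  have "curvature s n * W \<le> 21/8 * s\<^sup>2 * sqrt X"
  proof (rule half)
    show "0 \<le> W" unfolding W_def by (rule sum_nonneg) (use q in auto)
    show "W \<le> X" unfolding W_def X_def by (rule sum_mono) (rule q1)
    have "W \<le> (\<Sum>j<n. 1/4)" unfolding W_def by (rule sum_mono) (rule q4)
    then show "W \<le> real n / 4" by simp
  qed
  moreover have "curvature s (card J) * V \<le> 21/8 * s\<^sup>2 * sqrt X"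
  proof (rule half)
    show "0 \<le> V" unfolding V_def by (rule sum_nonneg) (use v in auto)
    have "V \<le> (\<Sum>j\<in>J. q j)" unfolding V_def by (rule sum_mono) (use v q1 order_trans in blast)
    also have "\<dots> \<le> X" unfolding X_def by (rule sum_mono2) (use J q in auto)
    finally show "V \<le> X" .
    have "V \<le> (\<Sum>j\<in>J. 1/4)" unfolding V_def by (rule sum_mono) (use v q4 order_trans in blast)
    then show "V \<le> real (card J) / 4" by simp
  qed
  moreover have "(exp s - 1) * X \<le> (s + s\<^sup>2 / 2 + \<bar>s\<bar> ^ 3 / 5) * X"
    using exp_le_cubic[OF s] X0 by (intro mult_right_mono) auto
  ultimately have 2: "(exp s - 1) * X + curvature s n * W + curvature s (card J) * V
      \<le> s * X + ((s\<^sup>2 / 2 + \<bar>s\<bar> ^ 3 / 5) * X + 21/4 * s\<^sup>2 * sqrt X)"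
    by (simp add: algebra_simps)
  have "partial_hit_expectation n d g J C f (\<lambda>y. exp (s * (y - X))) = exp (- (s * X)) * partial_hit_expectation n d g J C f (\<lambda>y. exp (s * y))"
    unfolding partial_hit_expectation_def avg_cmult[symmetric] hit_expectation_cmult[symmetric]
    by (simp add: exp_add[symmetric] algebra_simps)
  also have "\<dots> \<le> exp (- (s * X)) * exp (s * X + ((s\<^sup>2 / 2 + \<bar>s\<bar> ^ 3 / 5) * X + 21/4 * s\<^sup>2 * sqrt X))"
    using 1 2 by (intro mult_left_mono) (auto intro: order_trans)
  also have "\<dots> = exp ((s\<^sup>2 / 2 + \<bar>s\<bar> ^ 3 / 5) * X + 21/4 * s\<^sup>2 * sqrt X)"
    by (simp add: exp_add[symmetric])
  finally show "partial_hit_expectation n d g J C f (\<lambda>y. exp (s * (y - (\<Sum>j<n. row_mean n d g J C f j))))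
      \<le> exp ((s\<^sup>2 / 2 + \<bar>s\<bar> ^ 3 / 5) * (\<Sum>j<n. row_mean n d g J C f j)
        + 21/4 * s\<^sup>2 * sqrt (\<Sum>j<n. row_mean n d g J C f j))"
    by (simp add: X_def q_def)
qed

section \<open>Martingales with bounded steps\<close>

text \<open>\<open>martingale_tree x E\<close>: the distribution with expectation functional \<open>E\<close> arises at the leaves of a tree of
  uniform random choices whose nodes carry values, starting from \<open>x\<close> at the root.\<close>

inductive martingale_tree :: "real \<Rightarrow> ((real \<Rightarrow> real) \<Rightarrow> real) \<Rightarrow> bool" where
  leaf: "martingale_tree x (\<lambda>\<phi>. \<phi> x)"
| node: "finite I \<Longrightarrow> I \<noteq> {} \<Longrightarrow> (\<And>i. i \<in> I \<Longrightarrow> martingale_tree (x i) (E i)) \<Longrightarrow> (\<And>i. i \<in> I \<Longrightarrow> \<bar>x i - y\<bar> \<le> 2)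
    \<Longrightarrow> subgamma y (\<lambda>\<phi>. avg (I :: nat set) (\<lambda>i. E i \<phi>)) \<Longrightarrow> martingale_tree y (\<lambda>\<phi>. avg I (\<lambda>i. E i \<phi>))"

text \<open>Monotonicity and scaling give Markov's inequality; the complement rule turns an upper
  bound on falling back into a lower bound on staying away.\<close>

definition expectation_like :: "((real \<Rightarrow> real) \<Rightarrow> real) \<Rightarrow> bool" where
  "expectation_like E \<longleftrightarrow> (\<forall>\<phi> \<psi>. (\<forall>y. \<phi> y \<le> \<psi> y) \<longrightarrow> E \<phi> \<le> E \<psi>) \<and> (\<forall>c \<phi>. E (\<lambda>y. c * \<phi> y) = c * E \<phi>)
    \<and> (\<forall>\<phi>. E (\<lambda>y. 1 - \<phi> y) = 1 - E \<phi>)"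

lemma expectation_likeD:
  assumes "expectation_like E"
  shows "(\<And>y. \<phi> y \<le> \<psi> y) \<Longrightarrow> E \<phi> \<le> E \<psi>" "E (\<lambda>y. c * \<phi> y) = c * E \<phi>" "E (\<lambda>y. 1 - \<phi> y) = 1 - E \<phi>"
  using assms unfolding expectation_like_def by auto

lemma expectation_like_avg:
  assumes "finite I" "I \<noteq> {}" "\<And>i. i \<in> I \<Longrightarrow> expectation_like (E i)"
  shows "expectation_like (\<lambda>\<phi>. avg I (\<lambda>i. E i \<phi>))"
  unfolding expectation_like_def
proof (intro conjI allI impI)
  fix \<phi> \<psi> :: "real \<Rightarrow> real" assume "\<forall>y. \<phi> y \<le> \<psi> y"
  then show "avg I (\<lambda>i. E i \<phi>) \<le> avg I (\<lambda>i. E i \<psi>)"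
    by (intro avg_mono) (use assms in \<open>auto simp: expectation_like_def\<close>)
next
  fix c \<phi>
  have "avg I (\<lambda>i. E i (\<lambda>y. c * \<phi> y)) = avg I (\<lambda>i. c * E i \<phi>)"
    by (rule avg_cong) (use assms in \<open>auto simp: expectation_like_def\<close>)
  then show "avg I (\<lambda>i. E i (\<lambda>y. c * \<phi> y)) = c * avg I (\<lambda>i. E i \<phi>)" by (simp add: avg_cmult)
next
  fix \<phi>
  have "avg I (\<lambda>i. E i (\<lambda>y. 1 - \<phi> y)) = avg I (\<lambda>i. 1 - E i \<phi>)"
    by (rule avg_cong) (use assms in \<open>auto simp: expectation_like_def\<close>)
  then show "avg I (\<lambda>i. E i (\<lambda>y. 1 - \<phi> y)) = 1 - avg I (\<lambda>i. E i \<phi>)"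
    using assms by (simp add: avg_diff avg_const)
qed

lemma martingale_tree_expectation_like: "martingale_tree x E \<Longrightarrow> expectation_like E"
proof (induction rule: martingale_tree.induct)
  case (leaf x)
  then show ?case by (simp add: expectation_like_def)
qed (auto intro: expectation_like_avg)

section \<open>Chernoff bounds\<close>

lemma subgamma_chernoff:
  assumes sg: "subgamma X E" and E: "expectation_like E" and \<delta>: "\<delta> \<in> {-1, 1}" and t: "0 \<le> t" "t \<le> 1/4"
    and imp: "\<And>y. R y \<Longrightarrow> u \<le> \<delta> * (y - X)"
  shows "E (\<lambda>y. of_bool (R y)) \<le> exp (- (t * u) + (t\<^sup>2 / 2 + t ^ 3 / 5) * X + 21/4 * t\<^sup>2 * sqrt X)"
proof -
  have "of_bool (R y) \<le> exp (- (t * u)) * exp (\<delta> * t * (y - X))" for y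
  proof (cases "R y")
    case True
    then have "0 \<le> t * (\<delta> * (y - X) - u)" using imp t by (intro mult_nonneg_nonneg) auto
    then have "1 \<le> exp (t * (\<delta> * (y - X) - u))" by simp
    then show ?thesis using True by (simp add: exp_add[symmetric] algebra_simps)
  qed simp
  then have "E (\<lambda>y. of_bool (R y)) \<le> E (\<lambda>y. exp (- (t * u)) * exp (\<delta> * t * (y - X)))"
    by (rule expectation_likeD(1)[OF E])
  also have "\<dots> = exp (- (t * u)) * E (\<lambda>y. exp (\<delta> * t * (y - X)))"
    by (rule expectation_likeD(2)[OF E])
  also have "E (\<lambda>y. exp (\<delta> * t * (y - X)))
      \<le> exp (((\<delta> * t)\<^sup>2 / 2 + \<bar>\<delta> * t\<bar> ^ 3 / 5) * X + 21/4 * (\<delta> * t)\<^sup>2 * sqrt X)"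
  proof -
    have "\<bar>\<delta> * t\<bar> \<le> 1/4" using \<delta> t by auto
    then show ?thesis using sg unfolding subgamma_def by blast
  qed
  also have "((\<delta> * t)\<^sup>2 / 2 + \<bar>\<delta> * t\<bar> ^ 3 / 5) * X + 21/4 * (\<delta> * t)\<^sup>2 * sqrt X
      = (t\<^sup>2 / 2 + t ^ 3 / 5) * X + 21/4 * t\<^sup>2 * sqrt X"
    using \<delta> t by auto
  finally show ?thesis by (simp add: exp_add[symmetric] algebra_simps)
qed

text \<open>The choice of \<open>w\<close> keeps \<open>w \<le> 1/4\<close> for every
  \<open>t\<close> and is close to the optimum \<open>t / M\<close> when \<open>t\<close> is small
  against \<open>M\<close>. The coefficient 1 of \<open>w^3\<close>, against 1/5 in
  \<open>exp_le_cubic\<close>, leaves \<open>4/5 * w^3 * M\<close> for other errors.\<close>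

lemma chernoff_exponent:
  fixes M t :: real
  assumes "M \<ge> 0" "t > 0"
  defines "w \<equiv> t / (M + 4 * t)"
  shows "- (w * t) + M * (w\<^sup>2 / 2 + w ^ 3) \<le> - (t\<^sup>2 / (2 * M + 4 * t))"
proof -
  define a where "a = M + 4 * t"
  define b where "b = M + 2 * t"
  have ab: "a > 0" "b > 0" using assms by (simp_all add: a_def b_def)
  \<comment> \<open>The difference of the two sides is exactly this quantity.\<close>
  have "0 \<le> t\<^sup>2 * (4 * M * t\<^sup>2) / (2 * a ^ 3 * b)" using assms ab by simp
  also have "4 * M * t\<^sup>2 = 2 * a\<^sup>2 * b - M * a * b - 2 * M * t * b - a ^ 3"
    by (simp add: a_def b_def power2_eq_square power3_eq_cube algebra_simps)
  also have "t\<^sup>2 * (2 * a\<^sup>2 * b - M * a * b - 2 * M * t * b - a ^ 3) / (2 * a ^ 3 * b)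
      = t\<^sup>2 / a - M * (t\<^sup>2 / a\<^sup>2) / 2 - M * (t ^ 3 / a ^ 3) - t\<^sup>2 / (2 * b)"
    using ab by (simp add: power2_eq_square power3_eq_cube divide_simps) (simp add: algebra_simps)
  also have "\<dots> = w * t - M * (w\<^sup>2 / 2 + w ^ 3) - t\<^sup>2 / (2 * M + 4 * t)"
  proof -
    have wa: "w = t / a" and b2: "2 * M + 4 * t = 2 * b" by (simp_all add: w_def a_def b_def)
    show ?thesis unfolding wa b2 by (simp add: power_divide power2_eq_square algebra_simps)
  qed
  finally show ?thesis by linarith
qed

text \<open>From a start in the window, passing \<open>2 * lam + 2 * mu\<close> takes a further rise
  of at least \<open>2 * mu + (lam - 2)\<close>: the part \<open>2 * mu\<close> yields the exponent,
  and \<open>lam - 2\<close> pays for the \<open>sqrt X\<close> term. The probability on the right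
  is at least 1/4, by the same Chernoff bound in the opposite direction.\<close>

lemma far_node_tail:
  fixes m lam mu X \<delta> :: real
  assumes sg: "subgamma X E" and E: "expectation_like E" and \<delta>: "\<delta> \<in> {-1, 1}"
    and m: "0 \<le> m" "2 * sqrt m + 1 \<le> lam" and lam: "9 \<le> lam" and mu: "0 < mu"
    and far: "lam \<le> \<delta> * (X - m)" "\<delta> * (X - m) \<le> lam + 2"
  shows "E (\<lambda>y. of_bool (\<delta> * (y - m) > 2 * lam + 2 * mu))
    \<le> E (\<lambda>y. of_bool (\<delta> * (y - m) \<ge> 1)) * (4 * exp (- (mu\<^sup>2 / ((m + 2 * lam) / 2 + 2 * mu))))"
proof -
  have X0: "0 \<le> X" using sg by (simp add: subgamma_def)
  have Xm: "X \<le> m + lam + 2" using \<delta> far lam by auto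
  have "(2 * sqrt m)\<^sup>2 \<le> (lam - 1)\<^sup>2" using m by (intro power_mono) auto
  then have m4: "4 * m \<le> (lam - 1)\<^sup>2" using m by (simp add: power_mult_distrib)
  have "4 * X \<le> (lam - 1)\<^sup>2 + 4 * lam + 8" using Xm m4 by linarith
  \<comment> \<open>The inequality amounts to \<open>lam \<ge> 8.8\<close>, so
    \<open>9 \<le> lam\<close> is used here.\<close>
  also have "\<dots> \<le> (lam + 7/5)\<^sup>2" using lam by (simp add: power2_eq_square algebra_simps)
  finally have X4: "X \<le> ((lam + 7/5) / 2)\<^sup>2" by (simp add: power_divide)
  have rX: "sqrt X \<le> (lam + 7/5) / 2"
    by (rule real_le_lsqrt[OF _ X4]) (use lam in simp)
  define t where "t = 2 * mu"
  define M where "M = m + 2 * lam"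
  define w where "w = t / (M + 4 * t)"
  have t: "t > 0" and M: "M \<ge> 0" "X \<le> M" using mu m lam Xm by (simp_all add: t_def M_def)
  have w: "0 \<le> w" "w \<le> 1/4" using t M by (simp_all add: w_def divide_simps)
  have "E (\<lambda>y. of_bool (\<delta> * (y - m) > 2 * lam + 2 * mu))
      \<le> exp (- (w * (t + (lam - 2))) + (w\<^sup>2 / 2 + w ^ 3 / 5) * X + 21/4 * w\<^sup>2 * sqrt X)"
    by (rule subgamma_chernoff[OF sg E \<delta> w]) (use far in \<open>simp add: t_def algebra_simps\<close>)
  also have "\<dots> \<le> exp (- (t\<^sup>2 / (2 * M + 4 * t)))"
  proof -
    have "(w\<^sup>2 / 2 + w ^ 3 / 5) * X \<le> (w\<^sup>2 / 2 + w ^ 3) * M"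
      using w M X0 by (intro mult_mono add_mono) auto
    moreover have "21/4 * w\<^sup>2 * sqrt X \<le> w * (lam - 2)"
    proof -
      have "21/4 * w * sqrt X \<le> 21/4 * (1/4) * ((lam + 7/5) / 2)"
        using w rX X0 by (intro mult_mono) auto
      also have "\<dots> \<le> lam - 2" using lam by simp
      finally have "w * (21/4 * w * sqrt X) \<le> w * (lam - 2)" using w by (intro mult_left_mono) auto
      then show ?thesis by (simp add: power2_eq_square mult_ac)
    qed
    ultimately show ?thesis
      using chernoff_exponent[OF M(1) t, folded w_def] by (simp add: algebra_simps)
  qed
  also have "t\<^sup>2 / (2 * M + 4 * t) = mu\<^sup>2 / ((m + 2 * lam) / 2 + 2 * mu)"
  proof -
    have "t\<^sup>2 = 4 * mu\<^sup>2" "2 * M + 4 * t = 4 * ((m + 2 * lam) / 2 + 2 * mu)"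
      by (simp_all add: t_def M_def power2_eq_square)
    then show ?thesis by (metis mult_divide_mult_cancel_left zero_neq_numeral)
  qed
  finally have 1: "E (\<lambda>y. of_bool (\<delta> * (y - m) > 2 * lam + 2 * mu)) \<le> exp (- (mu\<^sup>2 / ((m + 2 * lam) / 2 + 2 * mu)))" .
  define u where "u = lam - 1"
  \<comment> \<open>The drop of at least \<open>lam - 1\<close> then contributes the constant
    \<open>v * u = 4/5\<close>, while \<open>v * sqrt X\<close> stays bounded because
    \<open>2 * sqrt m \<le> lam - 1\<close>. The exponent is below
    \<open>- 4/5 + 0.15 + 0.28 < - 1/3\<close>.\<close>
  define v where "v = 4/5 / u"
  have u: "8 \<le> u" using lam by (simp add: u_def)
  have v: "0 \<le> v" "v \<le> 1/10" "v * u = 4/5" using u by (simp_all add: v_def divide_simps)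
  have "E (\<lambda>y. of_bool (\<not> \<delta> * (y - m) \<ge> 1))
      \<le> exp (- (v * u) + (v\<^sup>2 / 2 + v ^ 3 / 5) * X + 21/4 * v\<^sup>2 * sqrt X)"
    by (rule subgamma_chernoff[OF sg E, of "- \<delta>"]) (use \<delta> v far in \<open>auto simp: u_def algebra_simps\<close>)
  also have "\<dots> \<le> exp (- (1/3))"
  proof -
    have sqX: "v * ((lam + 7/5) / 2) \<le> 13/25"
      using v u by (simp add: u_def algebra_simps)
    have "v\<^sup>2 * X \<le> (v * ((lam + 7/5) / 2))\<^sup>2"
      using mult_left_mono[OF X4 zero_le_power2, of v] by (simp only: power_mult_distrib)
    also have "\<dots> \<le> (13/25)\<^sup>2" using sqX v lam by (intro power_mono) auto
    also have "\<dots> \<le> 28/100" by (simp add: power2_eq_square)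
    finally have vX: "v\<^sup>2 * X \<le> 28/100" .
    have "(v\<^sup>2 / 2 + v ^ 3 / 5) * X = (1/2 + v / 5) * (v\<^sup>2 * X)"
      by (simp add: power2_eq_square power3_eq_cube algebra_simps)
    also have "\<dots> \<le> (1/2 + 1/50) * (28/100)"
      using v vX X0 by (intro mult_mono) auto
    finally have a: "(v\<^sup>2 / 2 + v ^ 3 / 5) * X \<le> (1/2 + 1/50) * (28/100)" .
    have "v * sqrt X \<le> 13/25" using mult_left_mono[OF rX v(1)] sqX by linarith
    then have "21/4 * v * (v * sqrt X) \<le> 21/4 * (1/10) * (13/25)"
      using v X0 by (intro mult_mono) auto
    then have b: "21/4 * v\<^sup>2 * sqrt X \<le> 21/4 * (1/10) * (13/25)"
      by (simp add: power2_eq_square mult_ac)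
    have "- x + y + z \<le> - (1/3)"
      if "y \<le> (1/2 + 1/50) * (28/100)" "z \<le> 21/4 * (1/10) * (13/25)" "x = 4/5" for x y z :: real
      using that by argo
    from this[OF a b v(3)] show ?thesis unfolding exp_le_cancel_iff .
  qed
  also have "exp (- (1/3)) \<le> (3/4 :: real)"
    using exp_ge_add_one_self[of "1/3 :: real"] by (simp add: exp_minus field_simps)
  finally have "E (\<lambda>y. of_bool (\<not> \<delta> * (y - m) \<ge> 1)) \<le> 3/4" .
  moreover have "E (\<lambda>y. of_bool (\<not> \<delta> * (y - m) \<ge> 1)) = 1 - E (\<lambda>y. of_bool (\<delta> * (y - m) \<ge> 1))"
    by (simp only: of_bool_not_iff expectation_likeD(3)[OF E])
  ultimately have "1 \<le> 4 * E (\<lambda>y. of_bool (\<delta> * (y - m) \<ge> 1))" by simp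
  note one = this
  note 1
  also have "exp (- (mu\<^sup>2 / ((m + 2 * lam) / 2 + 2 * mu)))
      \<le> 4 * E (\<lambda>y. of_bool (\<delta> * (y - m) \<ge> 1)) * exp (- (mu\<^sup>2 / ((m + 2 * lam) / 2 + 2 * mu)))"
    using mult_right_mono[OF one exp_ge_zero] by (simp only: mult_1)
  finally show ?thesis by (simp only: mult_ac)
qed

text \<open>A node beyond \<open>m + lam\<close> is handled by its exponential moments; below that level
  the recursion continues, and no step jumps past \<open>m + lam + 2\<close>.\<close>

lemma martingale_tree_tail:
  assumes "martingale_tree x E" and \<delta>: "\<delta> \<in> {-1, 1}"
    and m: "0 \<le> m" "2 * sqrt m + 1 \<le> lam" and lam: "9 \<le> lam" and mu: "0 < mu"
    and "\<delta> * (x - m) \<le> lam + 2"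
  shows "E (\<lambda>y. of_bool (\<delta> * (y - m) > 2 * lam + 2 * mu))
    \<le> E (\<lambda>y. of_bool (\<delta> * (y - m) \<ge> 1)) * (4 * exp (- (mu\<^sup>2 / ((m + 2 * lam) / 2 + 2 * mu))))"
  using assms(1,7)
proof (induction rule: martingale_tree.induct)
  case (leaf x)
  \<comment> \<open>A leaf value beyond \<open>m\<close> by at most \<open>lam + 2 < 2 * lam\<close>
    excludes the event on the left.\<close>
  then show ?case using lam mu by simp
next
  case (node I x E y)
  show ?case
  proof (cases "lam \<le> \<delta> * (y - m)")
    case True
    have "expectation_like (\<lambda>\<phi>. avg I (\<lambda>i. E i \<phi>))"
      using node.hyps martingale_tree_expectation_like by (intro expectation_like_avg) auto
    from far_node_tail[OF node.hyps(5) this \<delta> m lam mu True node.prems] show ?thesis .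
  next
    case False
    define c where "c = 4 * exp (- (mu\<^sup>2 / ((m + 2 * lam) / 2 + 2 * mu)))"
    have "avg I (\<lambda>i. E i (\<lambda>y. of_bool (\<delta> * (y - m) > 2 * lam + 2 * mu)))
        \<le> avg I (\<lambda>i. c * E i (\<lambda>y. of_bool (\<delta> * (y - m) \<ge> 1)))"
    proof (rule avg_mono)
      fix i assume i: "i \<in> I"
      have "\<delta> * (x i - m) \<le> lam + 2" using node.hyps(4)[OF i] False \<delta> by auto
      from node.IH[OF i this] show "E i (\<lambda>y. of_bool (\<delta> * (y - m) > 2 * lam + 2 * mu))
          \<le> c * E i (\<lambda>y. of_bool (\<delta> * (y - m) \<ge> 1))"
        by (simp add: c_def mult_ac)
    qed
    then have "avg I (\<lambda>i. E i (\<lambda>y. of_bool (\<delta> * (y - m) > 2 * lam + 2 * mu)))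
        \<le> c * avg I (\<lambda>i. E i (\<lambda>y. of_bool (\<delta> * (y - m) \<ge> 1)))"
      unfolding avg_cmult .
    then show ?thesis unfolding c_def by (simp only: mult.commute)
  qed
qed

section \<open>The number of hits as a martingale with steps of at most 2\<close>

lemma partial_hit_expectation_step:
  assumes "j \<in> J" "finite J" "finite C" "card J = card C"
  shows "partial_hit_expectation n d g J C f = (\<lambda>\<phi>. avg C (\<lambda>a. partial_hit_expectation n d g (J - {j}) (C - {a}) (f(j := a)) \<phi>))"
proof
  fix \<phi>
  have "(\<lambda>i l. g i ((if i \<in> J then (\<sigma>(j := a)) i else f i) # l))
      = (\<lambda>i l. g i ((if i \<in> J - {j} then \<sigma> i else (f(j := a)) i) # l))" for \<sigma> a
    using assms(1) by (auto simp: fun_eq_iff)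
  then show "partial_hit_expectation n d g J C f \<phi> = avg C (\<lambda>a. partial_hit_expectation n d g (J - {j}) (C - {a}) (f(j := a)) \<phi>)"
    unfolding partial_hit_expectation_def avg_bijs[OF assms] by simp
qed

text \<open>Revealing row \<open>j\<close> moves its own mean by at most 1. Each of the other
  \<open>card J - 1\<close> open rows loses one column and moves by at most
  \<open>1 / (card J - 1)\<close>, together at most 1.\<close>

lemma row_mean_jump:
  assumes n: "n > 0" and g: "\<And>j l. g j l \<in> {0, 1}" and J: "J \<subseteq> {..<n}" "j \<in> J"
    and C: "finite C" "card J = card C" "a \<in> C"
  shows "\<bar>(\<Sum>i<n. row_mean n d g (J - {j}) (C - {a}) (f(j := a)) i) - (\<Sum>i<n. row_mean n d g J C f i)\<bar> \<le> 2"
proof -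
  define A where "A = (\<lambda>j a. hit_density n d (\<lambda>l. g j (a # l)))"
  have A: "0 \<le> A i b \<and> A i b \<le> 1" for i b
    unfolding A_def by (rule hit_density_unit) (use n g in auto)
  have finJ: "finite J" using J finite_subset by blast
  have avgA: "0 \<le> avg C (A i)" "avg C (A i) \<le> 1" for i
    using avg_in_unit[of C "A i"] A C by auto
  define D where "D = (\<lambda>i. row_mean n d g (J - {j}) (C - {a}) (f(j := a)) i - row_mean n d g J C f i)"
  have D0: "D i = 0" if "i \<notin> J" for i using that J by (auto simp: D_def row_mean_def)
  have Dj: "\<bar>D j\<bar> \<le> 1"
  proof -
    have "D j = A j a - avg C (A j)" using J by (simp add: D_def row_mean_def A_def)
    then show ?thesis using A[of j a] avgA[of j] by (simp add: abs_le_iff)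
  qed
  have Di: "\<bar>D i\<bar> \<le> 1 / real (card (J - {j}))" if "i \<in> J - {j}" for i
  proof -
    have c1: "card (J - {j}) > 0" using that finJ by (auto simp: card_gt_0_iff)
    have cj: "card (J - {j}) = card J - 1" using J finJ by simp
    then have c2: "card C \<ge> 2" "real (card C) - 1 = real (card (J - {j}))"
      using c1 C by (auto simp: of_nat_diff)
    have "D i = - ((A i a - avg C (A i)) / (real (card C) - 1))"
      using that avg_remove[OF C(1,3) c2(1), of "A i"]
      by (simp add: D_def row_mean_def A_def)
    then have "\<bar>D i\<bar> = \<bar>A i a - avg C (A i)\<bar> / real (card (J - {j}))"
      using c2 by simp
    also have "\<dots> \<le> 1 / real (card (J - {j}))"
      using A[of i a] avgA[of i] by (intro divide_right_mono) (auto simp: abs_le_iff)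
    finally show ?thesis .
  qed
  have "(\<Sum>i<n. D i) = (\<Sum>i\<in>J. D i)"
    by (rule sum.mono_neutral_right) (use J D0 in auto)
  also have "\<dots> = D j + (\<Sum>i\<in>J - {j}. D i)" using J finJ by (simp add: sum.remove)
  finally have S: "(\<Sum>i<n. D i) = D j + (\<Sum>i\<in>J - {j}. D i)" .
  have "\<bar>\<Sum>i\<in>J - {j}. D i\<bar> \<le> (\<Sum>i\<in>J - {j}. 1 / real (card (J - {j})))"
    by (rule order_trans[OF sum_abs sum_mono]) (use Di in auto)
  also have "\<dots> \<le> 1" by simp
  finally have "\<bar>\<Sum>i<n. D i\<bar> \<le> 2" using S Dj by linarith
  then show ?thesis by (simp add: D_def sum_subtractf)
qed

text \<open>Two nested inductions, over coordinates and, inside one coordinate, over the rows still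
  open. A state without open rows is the starting state of the next coordinate, so the trees are
  glued there.\<close>

lemma martingale_tree_expec:
  assumes n: "n \<ge> 3" and g: "\<And>j l. g j l \<in> {0, 1}"
  shows "martingale_tree (\<Sum>j<n. hit_density n d (g j)) (hit_expectation n d g)"
  using g
proof (induction d arbitrary: g)
  case 0
  have "hit_expectation n 0 g = (\<lambda>\<phi>. \<phi> (\<Sum>j<n. g j []))" by (simp add: fun_eq_iff)
  then show ?case by (simp add: martingale_tree.leaf)
next
  case (Suc d)
  have part: "martingale_tree (\<Sum>j<n. row_mean n d g J C f j) (partial_hit_expectation n d g J C f)"
    if "J \<subseteq> {..<n}" "finite C" "card J = card C" for J C f
    using that
  proof (induction "card J" arbitrary: J C f)
    case 0
    then have JC: "J = {}" "C = {}" using finite_subset[of J "{..<n}"] by auto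
    have "partial_hit_expectation n d g J C f = hit_expectation n d (\<lambda>j l. g j (f j # l))"
      by (simp add: fun_eq_iff partial_hit_expectation_def JC bijs_empty avg_def)
    moreover have "martingale_tree (\<Sum>j<n. hit_density n d (\<lambda>l. g j (f j # l))) (hit_expectation n d (\<lambda>j l. g j (f j # l)))"
      by (rule Suc.IH) (rule Suc.prems)
    ultimately show ?case by (simp add: JC row_mean_def)
  next
    case (Suc r)
    have finJ: "finite J" using Suc.prems finite_subset by blast
    obtain j where j: "j \<in> J" using Suc.hyps(2) by fastforce
    have ne: "C \<noteq> {}" using Suc.prems Suc.hyps(2) by auto
    note eq = partial_hit_expectation_step[OF j finJ Suc.prems(2,3), of n d g f]
    have sg: "subgamma (\<Sum>j<n. row_mean n d g J C f j) (partial_hit_expectation n d g J C f)"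
      by (rule subgamma_partial_hit_expectation[OF n _ Suc.prems]) (rule \<open>\<And>l j. g j l \<in> {0, 1}\<close>)
    show ?case
      unfolding eq
    proof (rule martingale_tree.node[OF Suc.prems(2) ne])
      fix a assume a: "a \<in> C"
      show "martingale_tree (\<Sum>i<n. row_mean n d g (J - {j}) (C - {a}) (f(j := a)) i) (partial_hit_expectation n d g (J - {j}) (C - {a}) (f(j := a)))"
        using Suc.hyps(2) Suc.prems j a finJ by (intro Suc.hyps(1)) auto
      show "\<bar>(\<Sum>i<n. row_mean n d g (J - {j}) (C - {a}) (f(j := a)) i) - (\<Sum>i<n. row_mean n d g J C f i)\<bar> \<le> 2"
        by (rule row_mean_jump) (use n j a Suc.prems \<open>\<And>l j. g j l \<in> {0, 1}\<close> in auto)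
    qed (use sg eq in simp)
  qed
  \<comment> \<open>Members of \<open>bijs\<close> are extensional, so the value
    \<open>undefined\<close> outside \<open>J\<close> makes both expressions agree at every row
    index, not only below \<open>n\<close>.\<close>
  have "hit_expectation n (Suc d) g = partial_hit_expectation n d g {..<n} {1..n} (\<lambda>_. undefined)"
  proof
    fix \<phi>
    show "hit_expectation n (Suc d) g \<phi> = partial_hit_expectation n d g {..<n} {1..n} (\<lambda>_. undefined) \<phi>"
      unfolding partial_hit_expectation_def hit_expectation.simps
    proof (rule avg_cong)
      fix \<sigma> assume "\<sigma> \<in> bijs {..<n} {1..n}"
      then have "\<sigma> = (\<lambda>j. if j \<in> {..<n} then \<sigma> j else undefined)"
        by (auto simp: bijs_def PiE_iff extensional_def fun_eq_iff)
      then show "hit_expectation n d (\<lambda>j l. g j (\<sigma> j # l)) \<phi>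
          = hit_expectation n d (\<lambda>j l. g j ((if j \<in> {..<n} then \<sigma> j else undefined) # l)) \<phi>"
        by metis
    qed simp
  qed
  moreover have "(\<Sum>j<n. row_mean n d g {..<n} {1..n} (\<lambda>_. undefined) j) = (\<Sum>j<n. hit_density n (Suc d) (g j))"
    by (simp add: row_mean_def)
  ultimately show ?case using part[of "{..<n}" "{1..n}" "\<lambda>_. undefined"] by simp
qed

section \<open>Random perfect matchings\<close>

definition lists_of :: "'a set \<Rightarrow> nat \<Rightarrow> 'a list set" where
  "lists_of A d = {L. set L \<subseteq> A \<and> length L = d}"

lemma avg_lists_of_Suc:
  assumes "finite A"
  shows "avg (lists_of A (Suc d)) F = avg A (\<lambda>x. avg (lists_of A d) (\<lambda>L. F (x # L)))"
proof -
  have "lists_of A (Suc d) = (\<lambda>(x, L). x # L) ` (A \<times> lists_of A d)"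
    unfolding lists_of_def by (force simp: length_Suc_conv)
  moreover have inj: "inj_on (\<lambda>(x, L). x # L) (A \<times> lists_of A d)" by (auto simp: inj_on_def)
  ultimately have "(\<Sum>L\<in>lists_of A (Suc d). F L) = (\<Sum>(x, L)\<in>A \<times> lists_of A d. F (x # L))"
    by (simp add: sum.reindex case_prod_unfold)
  also have "\<dots> = (\<Sum>x\<in>A. \<Sum>L\<in>lists_of A d. F (x # L))"
    by (rule sum.cartesian_product[symmetric])
  finally have "(\<Sum>L\<in>lists_of A (Suc d). F L) = (\<Sum>x\<in>A. \<Sum>L\<in>lists_of A d. F (x # L))" .
  moreover have "card (lists_of A (Suc d)) = card A * card (lists_of A d)"
    unfolding lists_of_def using assms by (simp add: card_lists_length_eq)
  ultimately show ?thesis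
    by (simp add: avg_def sum_divide_distrib[symmetric] mult.commute)
qed

lemma avg_lists_of_0: "avg (lists_of A 0) F = F []"
proof -
  have "lists_of A 0 = {[]}" unfolding lists_of_def by auto
  then show ?thesis by (simp add: avg_def)
qed

lemma hit_density_eq_avg: "hit_density n d g = avg (lists_of {1..n} d) g"
  by (induction d arbitrary: g) (simp_all add: avg_lists_of_0 avg_lists_of_Suc)

lemma hit_expectation_eq_avg:
  "hit_expectation n d g \<phi> = avg (lists_of (bijs {..<n} {1..n}) d) (\<lambda>L. \<phi> (\<Sum>j<n. g j (map (\<lambda>f. f j) L)))"
  by (induction d arbitrary: g) (simp_all add: avg_lists_of_0 avg_lists_of_Suc finite_bijs)

text \<open>Linearity: the dependence between rows is invisible to the mean, as each row of a
  uniform bijection is uniform on \<open>{1..n}\<close>.\<close>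

lemma hit_expectation_id: "hit_expectation n d g (\<lambda>y. y) = (\<Sum>j<n. hit_density n d (g j))"
proof (induction d arbitrary: g)
  case (Suc d)
  have "hit_expectation n (Suc d) g (\<lambda>y. y) = (\<Sum>j<n. avg (bijs {..<n} {1..n}) (\<lambda>f. hit_density n d (\<lambda>l. g j (f j # l))))"
    using Suc by (simp add: avg_sum)
  also have "\<dots> = (\<Sum>j<n. avg {1..n} (\<lambda>a. hit_density n d (\<lambda>l. g j (a # l))))"
    by (intro sum.cong refl avg_bijs_marginal[where F = "\<lambda>a. hit_density n d (\<lambda>l. g _ (a # l))"]) auto
  finally show ?case by simp
qed simp

text \<open>Coordinate \<open>i\<close> sits at list position \<open>i - 1\<close>, and
  \<open>restrict\<close> supplies the extensionality that \<open>tuples\<close> asks for.\<close>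

definition tuple_of :: "nat \<Rightarrow> nat list \<Rightarrow> nat \<Rightarrow> nat" where
  "tuple_of k l = (\<lambda>i\<in>{1..k}. l ! (i - 1))"

lemma tuple_of_map_upt:
  assumes "f \<in> {1..k} \<rightarrow>\<^sub>E A"
  shows "tuple_of k (map f [1..<Suc k]) = f"
proof
  fix i
  show "tuple_of k (map f [1..<Suc k]) i = f i"
  proof (cases "i \<in> {1..k}")
    case True
    then have "map f [1..<Suc k] ! (i - 1) = f ([1..<Suc k] ! (i - 1))" by (intro nth_map) auto
    also have "[1..<Suc k] ! (i - 1) = 1 + (i - 1)" using True by (intro nth_upt) auto
    also have "1 + (i - 1) = i" using True by simp
    finally show ?thesis using True unfolding tuple_of_def by (simp only: restrict_apply if_True)
  next
    case False
    then show ?thesis using PiE_arb[OF assms False] unfolding tuple_of_def by (simp only: restrict_apply if_False)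
  qed
qed

lemma tuple_of_bij: "bij_betw (tuple_of k) (lists_of {1..n} k) (tuples n k)"
proof (rule bij_betwI[where g = "\<lambda>f. map f [1..<Suc k]"])
  show "tuple_of k \<in> lists_of {1..n} k \<rightarrow> tuples n k"
    by (auto simp: tuple_of_def lists_of_def tuples_def subset_iff)
  show "(\<lambda>f. map f [1..<Suc k]) \<in> tuples n k \<rightarrow> lists_of {1..n} k"
    by (auto simp: lists_of_def tuples_def PiE_iff simp del: upt_Suc)
  show "map (tuple_of k l) [1..<Suc k] = l" if "l \<in> lists_of {1..n} k" for l
    using that by (intro nth_equalityI) (auto simp: lists_of_def tuple_of_def simp del: upt_Suc)
  show "tuple_of k (map f [1..<Suc k]) = f" if "f \<in> tuples n k" for f
    by (rule tuple_of_map_upt[OF that[unfolded tuples_def]])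
qed

lemma hit_density_indicator:
  assumes "G \<subseteq> tuples n k"
  shows "hit_density n k (\<lambda>l. of_bool (tuple_of k l \<in> G)) = real (card G) / real n ^ k"
proof -
  have "(\<Sum>l\<in>lists_of {1..n} k. of_bool (tuple_of k l \<in> G) :: real) = (\<Sum>f\<in>tuples n k. of_bool (f \<in> G))"
    by (rule sum.reindex_bij_betw[OF tuple_of_bij])
  also have "\<dots> = real (card G)"
    using assms by (simp add: tuples_def finite_PiE of_bool_def sum.If_cases Int_absorb1)
  finally show ?thesis
    by (simp add: hit_density_eq_avg avg_def lists_of_def card_lists_length_eq)
qed

definition matching_of :: "nat \<Rightarrow> nat \<Rightarrow> (nat \<Rightarrow> nat) list \<Rightarrow> (nat \<Rightarrow> nat) list" where
  "matching_of n k L = map (\<lambda>j. tuple_of k (map (\<lambda>f. f j) L)) [0..<n]"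

text \<open>Transposition of an array of \<open>k\<close> coordinates by \<open>n\<close> rows.
  Disjointness of the tuples is injectivity of every coordinate map, and an injection of
  \<open>n\<close> rows into \<open>n\<close> values is a bijection; a uniform ordered matching is
  thus \<open>k\<close> independent uniform bijections.\<close>

lemma matching_of_bij:
  assumes k: "k > 0"
  shows "bij_betw (matching_of n k) (lists_of (bijs {..<n} {1..n}) k) (ordered_perfect_matchings n k)"
proof (rule bij_betwI[where g = "\<lambda>M. map (\<lambda>i. \<lambda>j\<in>{..<n}. (M ! j) i) [1..<Suc k]"])
  have entry: "tuple_of k (map (\<lambda>f. f j) L) i = (L ! (i - 1)) j" "L ! (i - 1) \<in> bijs {..<n} {1..n}"
    if "L \<in> lists_of (bijs {..<n} {1..n}) k" "i \<in> {1..k}" for L i j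
    using that nth_mem[of "i - 1" L] by (auto simp: tuple_of_def lists_of_def)
  show "matching_of n k \<in> lists_of (bijs {..<n} {1..n}) k \<rightarrow> ordered_perfect_matchings n k"
  proof (rule funcsetI)
    fix L assume L: "L \<in> lists_of (bijs {..<n} {1..n}) k"
    define T where "T = (\<lambda>j. tuple_of k (map (\<lambda>f. f j) L))"
    have dis: "disjoint_tuples k (T j) (T j')" if "j < n" "j' < n" "j \<noteq> j'" for j j'
      unfolding disjoint_tuples_def T_def
    proof
      fix i assume i: "i \<in> {1..k}"
      have "inj_on (L ! (i - 1)) {..<n}" using entry(2)[OF L i] by (simp add: bijs_def bij_betw_def)
      then show "tuple_of k (map (\<lambda>f. f j) L) i \<noteq> tuple_of k (map (\<lambda>f. f j') L) i"
        using that by (auto simp: entry(1)[OF L i] inj_on_def)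
    qed
    \<comment> \<open>Disjoint tuples differ only if there is a coordinate to compare;
      \<open>k > 0\<close> supplies coordinate 1.\<close>
    have neq: "T j \<noteq> T j'" if "j < n" "j' < n" "j \<noteq> j'" for j j'
    proof -
      have "T j 1 \<noteq> T j' 1"
        using dis[OF that] k by (simp add: disjoint_tuples_def)
      then show ?thesis by metis
    qed
    have inj: "inj_on T {0..<n}" by (rule inj_onI, rule ccontr) (use neq in auto)
    have "T j \<in> tuples n k" if "j < n" for j
      unfolding tuples_def
    proof (rule PiE_I)
      show "T j i \<in> {1..n}" if i: "i \<in> {1..k}" for i
        using entry(2)[OF L i] \<open>j < n\<close> by (auto simp: T_def entry(1)[OF L i] bijs_def PiE_iff)
    qed (auto simp: T_def tuple_of_def)
    moreover have "pairwise (disjoint_tuples k) (T ` {0..<n})"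
    proof (rule pairwiseI, elim imageE)
      fix x y j j' assume "x \<noteq> y" "x = T j" "y = T j'" "j \<in> {0..<n}" "j' \<in> {0..<n}"
      then show "disjoint_tuples k x y" using dis[of j j'] by (cases "j = j'") simp_all
    qed
    ultimately show "matching_of n k L \<in> ordered_perfect_matchings n k"
      using inj by (auto simp: ordered_perfect_matchings_def perfect_matching_def matching_of_def T_def[symmetric]
          distinct_map card_image)
  qed
  have nth: "length M = n" "j < n \<Longrightarrow> M ! j \<in> tuples n k"
      "j < n \<Longrightarrow> j' < n \<Longrightarrow> j \<noteq> j' \<Longrightarrow> disjoint_tuples k (M ! j) (M ! j')"
    if "M \<in> ordered_perfect_matchings n k" for M j j'
  proof -
    have M: "distinct M" "set M \<subseteq> tuples n k" "card (set M) = n" "pairwise (disjoint_tuples k) (set M)"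
      using that by (auto simp: ordered_perfect_matchings_def perfect_matching_def)
    then show len: "length M = n" by (simp add: distinct_card)
    show "M ! j \<in> tuples n k" if "j < n"
      using M(2) nth_mem[of j M] that by (simp add: len subset_iff)
    show "disjoint_tuples k (M ! j) (M ! j')" if "j < n" "j' < n" "j \<noteq> j'"
    proof (rule pairwiseD[OF M(4)])
      show "M ! j \<noteq> M ! j'" using nth_eq_iff_index_eq[OF M(1)] that by (simp add: len)
    qed (use that in \<open>simp_all add: len\<close>)
  qed
  show "(\<lambda>M. map (\<lambda>i. \<lambda>j\<in>{..<n}. (M ! j) i) [1..<Suc k]) \<in> ordered_perfect_matchings n k \<rightarrow> lists_of (bijs {..<n} {1..n}) k"
  proof (rule funcsetI)
    fix M assume "M \<in> ordered_perfect_matchings n k"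
    note M = nth[OF this]
    have "(\<lambda>j\<in>{..<n}. (M ! j) i) \<in> bijs {..<n} {1..n}" if i: "i \<in> {1..k}" for i
    proof -
      have inj: "inj_on (\<lambda>j\<in>{..<n}. (M ! j) i) {..<n}"
      proof (rule inj_onI, rule ccontr)
        fix j j' assume j: "j \<in> {..<n}" "j' \<in> {..<n}" "j \<noteq> j'"
          and eq: "(\<lambda>j\<in>{..<n}. (M ! j) i) j = (\<lambda>j\<in>{..<n}. (M ! j) i) j'"
        have "(M ! j) i \<noteq> (M ! j') i"
          using M(3)[of j j'] j i by (simp add: disjoint_tuples_def)
        then show False using eq j by simp
      qed
      have sub: "(\<lambda>j\<in>{..<n}. (M ! j) i) ` {..<n} \<subseteq> {1..n}"
      proof (rule image_subsetI)
        fix j assume "j \<in> {..<n}"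
        then show "(\<lambda>j\<in>{..<n}. (M ! j) i) j \<in> {1..n}"
          using PiE_mem[OF M(2)[of j, unfolded tuples_def] i] by simp
      qed
      then have "(\<lambda>j\<in>{..<n}. (M ! j) i) ` {..<n} = {1..n}"
        using card_image[OF inj] by (intro card_subset_eq) auto
      moreover have "(\<lambda>j\<in>{..<n}. (M ! j) i) \<in> {..<n} \<rightarrow>\<^sub>E {1..n}"
        using sub by (auto simp: image_subset_iff)
      ultimately show ?thesis using inj unfolding bijs_def bij_betw_def by blast
    qed
    then show "map (\<lambda>i. \<lambda>j\<in>{..<n}. (M ! j) i) [1..<Suc k] \<in> lists_of (bijs {..<n} {1..n}) k"
      by (auto simp: lists_of_def simp del: upt_Suc)
  qed
  show "map (\<lambda>i. \<lambda>j\<in>{..<n}. (matching_of n k L ! j) i) [1..<Suc k] = L"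
    if L: "L \<in> lists_of (bijs {..<n} {1..n}) k" for L
  proof (rule nth_equalityI)
    show len: "length (map (\<lambda>i. \<lambda>j\<in>{..<n}. (matching_of n k L ! j) i) [1..<Suc k]) = length L"
      using L by (simp add: lists_of_def del: upt_Suc)
    fix i assume "i < length (map (\<lambda>i. \<lambda>j\<in>{..<n}. (matching_of n k L ! j) i) [1..<Suc k])"
    then have i: "i < k" "Suc i \<in> {1..k}" by (simp_all del: upt_Suc)
    have "(\<lambda>j\<in>{..<n}. (matching_of n k L ! j) (Suc i)) = (\<lambda>j\<in>{..<n}. (L ! i) j)"
    proof (rule restrict_ext)
      fix j assume "j \<in> {..<n}"
      then show "(matching_of n k L ! j) (Suc i) = (L ! i) j"
        using entry(1)[OF L i(2), of j] by (simp add: matching_of_def)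
    qed
    also have "\<dots> = L ! i"
    proof (rule PiE_restrict)
      show "L ! i \<in> {..<n} \<rightarrow>\<^sub>E {1..n}" using entry(2)[OF L i(2)] by (simp add: bijs_def)
    qed
    finally have eq: "(\<lambda>j\<in>{..<n}. (matching_of n k L ! j) (Suc i)) = L ! i" .
    have "[1..<Suc k] ! i = Suc i" using i by (simp del: upt_Suc)
    then show "map (\<lambda>i. \<lambda>j\<in>{..<n}. (matching_of n k L ! j) i) [1..<Suc k] ! i = L ! i"
      using i by (simp only: nth_map length_upt eq) (simp only: nth_map[of i "[1..<Suc k]"] length_upt diff_Suc_1 eq)
  qed
  show "matching_of n k (map (\<lambda>i. \<lambda>j\<in>{..<n}. (M ! j) i) [1..<Suc k]) = M"
    if M: "M \<in> ordered_perfect_matchings n k" for M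
  proof (rule nth_equalityI)
    show "length (matching_of n k (map (\<lambda>i. \<lambda>j\<in>{..<n}. (M ! j) i) [1..<Suc k])) = length M"
      using nth(1)[OF M] by (simp add: matching_of_def del: upt_Suc)
    fix j assume "j < length (matching_of n k (map (\<lambda>i. \<lambda>j\<in>{..<n}. (M ! j) i) [1..<Suc k]))"
    then have j: "j < n" by (simp add: matching_of_def del: upt_Suc)
    then have Mj: "M ! j \<in> {1..k} \<rightarrow>\<^sub>E {1..n}" using nth(2)[OF M] by (simp add: tuples_def)
    have "matching_of n k (map (\<lambda>i. \<lambda>j\<in>{..<n}. (M ! j) i) [1..<Suc k]) ! j = tuple_of k (map (M ! j) [1..<Suc k])"
      using j by (simp add: matching_of_def comp_def del: upt_Suc)
    also have "\<dots> = M ! j"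
      by (rule tuple_of_map_upt[OF Mj])
    finally show "matching_of n k (map (\<lambda>i. \<lambda>j\<in>{..<n}. (M ! j) i) [1..<Suc k]) ! j = M ! j" .
  qed
qed

text \<open>The tuples of a matching are distinct, so its hit members may be counted row by
  row.\<close>

lemma hits_matching_of:
  assumes k: "k > 0" and L: "L \<in> lists_of (bijs {..<n} {1..n}) k"
  shows "hits G (matching_of n k L) = (\<Sum>j<n. of_bool (tuple_of k (map (\<lambda>f. f j) L) \<in> G))"
proof -
  have "matching_of n k L \<in> ordered_perfect_matchings n k"
    using bij_betwE[OF matching_of_bij[OF k]] L by blast
  then have "distinct (matching_of n k L)" by (simp add: ordered_perfect_matchings_def)
  then have inj: "inj_on (\<lambda>j. tuple_of k (map (\<lambda>f. f j) L)) {0..<n}"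
    by (simp add: matching_of_def distinct_map)
  have "hits G (matching_of n k L) = (\<Sum>x\<in>set (matching_of n k L). of_bool (x \<in> G))"
    unfolding hits_def by (simp add: of_bool_def sum.If_cases Int_commute)
  also have "\<dots> = (\<Sum>j\<in>{0..<n}. of_bool (tuple_of k (map (\<lambda>f. f j) L) \<in> G))"
    by (simp add: matching_of_def sum.reindex[OF inj])
  finally show ?thesis by (simp add: atLeast0LessThan)
qed

lemma avg_matchings:
  assumes k: "k > 0"
  shows "avg (ordered_perfect_matchings n k) (\<lambda>M. \<phi> (hits G M)) = hit_expectation n k (\<lambda>j l. of_bool (tuple_of k l \<in> G)) \<phi>"
proof -
  let ?A = "lists_of (bijs {..<n} {1..n}) k"
  have "avg (ordered_perfect_matchings n k) (\<lambda>M. \<phi> (hits G M)) = avg ?A (\<lambda>L. \<phi> (hits G (matching_of n k L)))"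
    unfolding avg_def
    by (simp add: sum.reindex_bij_betw[OF matching_of_bij[OF k], symmetric] bij_betw_same_card[OF matching_of_bij[OF k], symmetric])
  also have "\<dots> = avg ?A (\<lambda>L. \<phi> (\<Sum>j<n. of_bool (tuple_of k (map (\<lambda>f. f j) L) \<in> G)))"
    by (intro avg_cong refl) (simp add: hits_matching_of[OF k])
  finally show ?thesis by (simp add: hit_expectation_eq_avg)
qed

lemma expectation_hits:
  assumes "k > 0"
  shows "measure_pmf.expectation (random_ordered_perfect_matching n k) (hits G)
    = hit_expectation n k (\<lambda>j l. of_bool (tuple_of k l \<in> G)) (\<lambda>y. y)"
  unfolding random_ordered_perfect_matching_def avg_matchings[OF assms, symmetric]
  by (subst integral_pmf_of_set)
    (simp_all add: finite_ordered_perfect_matchings ordered_perfect_matchings_nonempty assms avg_def)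

lemma prob_hits:
  assumes "k > 0"
  shows "measure_pmf.prob (random_ordered_perfect_matching n k) {M. Q (hits G M)}
    = hit_expectation n k (\<lambda>j l. of_bool (tuple_of k l \<in> G)) (\<lambda>y. of_bool (Q y))"
proof -
  let ?S = "ordered_perfect_matchings n k"
  have "measure_pmf.prob (pmf_of_set ?S) {M. Q (hits G M)} = card (?S \<inter> {M. Q (hits G M)}) / card ?S"
    using assms by (simp add: measure_pmf_of_set finite_ordered_perfect_matchings ordered_perfect_matchings_nonempty)
  also have "\<dots> = avg ?S (\<lambda>M. of_bool (Q (hits G M)))"
    by (simp add: avg_def of_bool_def sum.If_cases finite_ordered_perfect_matchings)
  also have "\<dots> = hit_expectation n k (\<lambda>j l. of_bool (tuple_of k l \<in> G)) (\<lambda>y. of_bool (Q y))"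
    by (rule avg_matchings[OF assms])
  finally show ?thesis by (simp add: random_ordered_perfect_matching_def)
qed

section \<open>The first tail bound and the conclusion\<close>

lemma hit_expectation_of_bool_le:
  assumes "\<And>y. of_bool (R y) \<le> c * \<psi> y"
  shows "hit_expectation n d g (\<lambda>y. of_bool (R y)) \<le> c * hit_expectation n d g \<psi>"
  using hit_expectation_mono[of "\<lambda>y. of_bool (R y)" "\<lambda>y. c * \<psi> y"] assms by (simp add: hit_expectation_cmult)

lemma exp_two_thirds: "exp (2/3 :: real) \<le> 2"
proof -
  have "exp (2/3 :: real) = exp (1/3) * exp (1/3)" by (simp flip: exp_add)
  also have "\<dots> \<le> (1 + 1/3 + 3/5 * (1/3)\<^sup>2) * (1 + 1/3 + 3/5 * (1/3)\<^sup>2)"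
    by (intro mult_mono exp_le_quadratic) auto
  also have "\<dots> \<le> 2" by (simp add: power2_eq_square)
  finally show ?thesis .
qed

text \<open>At the root no coordinate is partly revealed, so the correction carries 21/8, half the
  coefficient in \<open>subgamma\<close>.\<close>

lemma hit_expectation_tail:
  assumes n: "n \<ge> 3" and g: "\<And>j l. g j l \<in> {0, 1}" and hit_density: "\<And>j. hit_density n d (g j) = \<alpha>"
    and \<delta>: "\<delta> \<in> {-1, 1}" and t: "t > 0"
  shows "hit_expectation n d g (\<lambda>y. of_bool (\<delta> * (y - \<alpha> * real n) \<ge> t)) \<le> 2 * exp (- (t\<^sup>2 / (2 * (\<alpha> * real n) + 4 * t)))"
proof -
  define m where "m = \<alpha> * real n"
  have \<alpha>: "0 \<le> \<alpha>" "\<alpha> \<le> 1" using hit_density_unit[of n "g 0" d] hit_density[of 0] g n by auto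
  have m0: "m \<ge> 0" using \<alpha> by (simp add: m_def)
  define w where "w = t / (m + 4 * t)"
  have w: "0 \<le> w" "w \<le> 1/4" using t m0 by (simp_all add: w_def divide_simps)
  define s where "s = \<delta> * w"
  have s: "\<bar>s\<bar> = w" "s\<^sup>2 = w\<^sup>2" "\<bar>s\<bar> \<le> 1/4" using \<delta> w by (auto simp: s_def)
  define W where "W = real n * (\<alpha> * (1 - \<alpha>))"
  have W: "0 \<le> W" "W \<le> m" "W \<le> real n / 4"
  proof -
    show "0 \<le> W" using \<alpha> by (simp add: W_def)
    have "\<alpha> * (1 - \<alpha>) \<le> \<alpha>" using \<alpha> by (simp add: mult_left_le)
    then have "real n * (\<alpha> * (1 - \<alpha>)) \<le> real n * \<alpha>" by (intro mult_left_mono) auto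
    then show "W \<le> m" unfolding W_def m_def mult.commute[of \<alpha> "real n"] .
    have "\<alpha> * (1 - \<alpha>) \<le> 1/4"
      using zero_le_power2[of "\<alpha> - 1/2"] by (simp add: power2_eq_square algebra_simps)
    then have "real n * (\<alpha> * (1 - \<alpha>)) \<le> real n * (1/4)" by (intro mult_left_mono) auto
    then show "W \<le> real n / 4" by (simp add: W_def)
  qed
  have "of_bool (\<delta> * (y - m) \<ge> t) \<le> exp (- (w * t) - s * m) * exp (s * y)" for y
  proof (cases "\<delta> * (y - m) \<ge> t")
    case True
    then have "0 \<le> w * (\<delta> * (y - m) - t)" using w by (intro mult_nonneg_nonneg) auto
    then have "1 \<le> exp (w * (\<delta> * (y - m) - t))" by simp
    then show ?thesis using True by (simp add: exp_add[symmetric] s_def algebra_simps)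
  qed simp
  then have "hit_expectation n d g (\<lambda>y. of_bool (\<delta> * (y - m) \<ge> t))
      \<le> exp (- (w * t) - s * m) * hit_expectation n d g (\<lambda>y. exp (s * y))"
    by (rule hit_expectation_of_bool_le)
  also have "\<dots> \<le> exp (- (w * t) - s * m) * exp ((exp s - 1) * m + curvature s n * W)"
  proof (rule mult_left_mono)
    have c: "0 \<le> curvature s n" "curvature s n \<le> 4/5 * \<bar>s\<bar>" using curvature_nonneg curvature_le[OF s(3) n] by simp_all
    have "hit_expectation n d g (\<lambda>y. exp (s * y)) \<le> (\<Prod>j<n. quad s (curvature s n) \<alpha>)"
      using hit_expectation_exp[OF s(3) n, where g = g and d = d] g by (simp add: hit_density)
    also have "\<dots> \<le> (\<Prod>j<n. exp ((exp s - 1) * \<alpha> + curvature s n * (\<alpha> * (1 - \<alpha>))))"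
    proof (rule prod_mono, intro conjI)
      show "0 \<le> quad s (curvature s n) \<alpha>"
        using quad_range(1)[OF s(3) c \<alpha>] by (auto simp: min_def split: if_splits intro: order_trans[OF exp_ge_zero])
      show "quad s (curvature s n) \<alpha> \<le> exp ((exp s - 1) * \<alpha> + curvature s n * (\<alpha> * (1 - \<alpha>)))"
        using exp_ge_add_one_self[of "(exp s - 1) * \<alpha> + curvature s n * (\<alpha> * (1 - \<alpha>))"] by (simp only: quad_def add.assoc)
    qed
    also have "\<dots> = exp ((exp s - 1) * m + curvature s n * W)"
      by (simp add: exp_of_nat_mult[symmetric] m_def W_def algebra_simps)
    finally show "hit_expectation n d g (\<lambda>y. exp (s * y)) \<le> exp ((exp s - 1) * m + curvature s n * W)" .
  qed simp
  also have "\<dots> = exp (- (w * t) - s * m + ((exp s - 1) * m + curvature s n * W))"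
    by (simp only: exp_add)
  also have "\<dots> \<le> exp (2/3 + - (t\<^sup>2 / (2 * m + 4 * t)))"
    unfolding exp_le_cancel_iff
  proof -
    have "exp s \<le> 1 + s + w\<^sup>2 / 2 + w ^ 3 / 5" using exp_le_cubic[OF s(3)] by (simp only: s)
    then have a: "(exp s - 1) * m \<le> (s + w\<^sup>2 / 2 + w ^ 3 / 5) * m"
      using m0 by (intro mult_right_mono) auto
    have "curvature s n * W \<le> curvature s n * (sqrt W * sqrt (real n) / 2)"
      using le_half_sqrt_mult[OF W(1) order_refl W(3)] by (intro mult_left_mono curvature_nonneg)
    also have "\<dots> = 21/8 * (w\<^sup>2 * sqrt W)" using n by (simp add: curvature_def s)
    \<comment> \<open>AM-GM splits the correction: \<open>21/16 * 9/16 \<le> 4/5\<close> fits the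
      slack between \<open>w^3\<close> in \<open>chernoff_exponent\<close> and
      \<open>w^3 / 5\<close> in \<open>exp_le_cubic\<close>, and
      \<open>21/16 * 16/9 * w \<le> 7/12 \<le> 2/3\<close> since \<open>w \<le> 1/4\<close>.\<close>
    also have "\<dots> \<le> 21/16 * (9/16 * w ^ 3 * W + 16/9 * w)"
    proof -
      have "0 \<le> w * (3/4 * (w * sqrt W) - 4/3)\<^sup>2" using w by simp
      also have "\<dots> = 9/16 * w ^ 3 * (sqrt W)\<^sup>2 - 2 * (w\<^sup>2 * sqrt W) + 16/9 * w"
        by (simp add: power2_eq_square power3_eq_cube algebra_simps)
      also have "(sqrt W)\<^sup>2 = W" using W(1) by simp
      finally have "2 * (w\<^sup>2 * sqrt W) \<le> 9/16 * w ^ 3 * W + 16/9 * w" by linarith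
      moreover have "21/8 * Y \<le> 21/16 * Z" if "2 * Y \<le> Z" for Y Z :: real using that by argo
      ultimately show ?thesis by blast
    qed
    also have "\<dots> \<le> 4/5 * (w ^ 3 * m) + 2/3"
    proof -
      have "w ^ 3 * W \<le> w ^ 3 * m" using W w by (intro mult_left_mono) auto
      moreover have "0 \<le> w ^ 3 * m" using w m0 by simp
      ultimately have "21/16 * (9/16 * (w ^ 3 * W) + 16/9 * w) \<le> 4/5 * (w ^ 3 * m) + 2/3"
        using w by argo
      then show ?thesis by (simp only: mult.assoc)
    qed
    finally have b: "curvature s n * W \<le> 4/5 * (w ^ 3 * m) + 2/3" .
    have c: "- (w * t) + m * (w\<^sup>2 / 2 + w ^ 3) \<le> - (t\<^sup>2 / (2 * m + 4 * t))"
      using chernoff_exponent[OF m0 t] by (simp only: w_def)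
    have "(s + w\<^sup>2 / 2 + w ^ 3 / 5) * m = s * m + m * (w\<^sup>2 / 2 + w ^ 3) - 4/5 * (w ^ 3 * m)"
      by (simp add: algebra_simps)
    then show "- (w * t) - s * m + ((exp s - 1) * m + curvature s n * W) \<le> 2/3 + - (t\<^sup>2 / (2 * m + 4 * t))"
      using a b c by linarith
  qed
  also have "\<dots> \<le> 2 * exp (- (t\<^sup>2 / (2 * m + 4 * t)))"
    unfolding exp_add using exp_two_thirds by (intro mult_right_mono) auto
  finally show ?thesis by (simp add: m_def)
qed

text \<open>If \<open>t \<le> 2\<close>, the right side is at least
  \<open>2 * exp (- 1/2) \<ge> 1\<close>; if \<open>t > 2\<close>, no deviation is that large for
  \<open>n \<le> 2\<close>.\<close>

lemma prob_tail_small: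
  assumes n: "n \<le> 2" and \<alpha>: "0 \<le> \<alpha>" "\<alpha> \<le> 1" and k: "k > 0"
    and \<delta>: "\<delta> \<in> {-1, 1}" and t: "t > 0"
  shows "measure_pmf.prob (random_ordered_perfect_matching n k) {M. \<delta> * (hits G M - \<alpha> * real n) \<ge> t}
    \<le> 2 * exp (- (t\<^sup>2 / (2 * (\<alpha> * real n) + 4 * t)))"
proof (cases "t \<le> 2")
  case True
  have "t\<^sup>2 / (2 * (\<alpha> * real n) + 4 * t) \<le> t\<^sup>2 / (4 * t)"
  proof (rule divide_left_mono)
    have "0 \<le> 2 * (\<alpha> * real n)" using \<alpha> by simp
    then show "4 * t \<le> 2 * (\<alpha> * real n) + 4 * t" "0 < (2 * (\<alpha> * real n) + 4 * t) * (4 * t)"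
      using t by (auto intro!: mult_pos_pos add_nonneg_pos)
  qed simp
  also have "\<dots> \<le> 1/2" using t True by (simp add: power2_eq_square)
  finally have "exp (- (1/2)) \<le> exp (- (t\<^sup>2 / (2 * (\<alpha> * real n) + 4 * t)))" by simp
  moreover have "1/2 \<le> exp (- (1/2) :: real)" using exp_ge_add_one_self[of "- (1/2) :: real"] by simp
  ultimately have "1 \<le> 2 * exp (- (t\<^sup>2 / (2 * (\<alpha> * real n) + 4 * t)))" by linarith
  then show ?thesis by (rule order_trans[OF measure_pmf.prob_le_1])
next
  case False
  have "set_pmf (random_ordered_perfect_matching n k) \<inter> {M. \<delta> * (hits G M - \<alpha> * real n) \<ge> t} = {}"
  proof -
    have "\<not> t \<le> \<delta> * (hits G M - \<alpha> * real n)" if "M \<in> ordered_perfect_matchings n k" for M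
    proof -
      have "card (G \<inter> set M) \<le> card (set M)" by (rule card_mono) auto
      also have "card (set M) = n" using that by (simp add: ordered_perfect_matchings_def perfect_matching_def)
      finally have "hits G M \<le> 2" "0 \<le> hits G M" using n by (simp_all add: hits_def)
      moreover have "\<alpha> * real n \<le> 1 * 2" using \<alpha> n by (intro mult_mono) auto
      moreover have "0 \<le> \<alpha> * real n" using \<alpha> by simp
      ultimately show ?thesis using False \<delta> by auto
    qed
    then show ?thesis
      using k by (auto simp: random_ordered_perfect_matching_def finite_ordered_perfect_matchings ordered_perfect_matchings_nonempty)
  qed
  then have "measure_pmf.prob (random_ordered_perfect_matching n k) {M. \<delta> * (hits G M - \<alpha> * real n) \<ge> t} = 0"
    by (simp add: measure_pmf_zero_iff)
  then show ?thesis by simp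
qed

theorem theorem4:
  fixes n k :: nat and G :: "(nat \<Rightarrow> nat) set" and \<alpha> :: real
  assumes "n > 0" and "k > 0"
    and "G \<subseteq> tuples n k"
    and "\<alpha> = real (card G) / real n ^ k"
  shows
    "measure_pmf.expectation (random_ordered_perfect_matching n k) (hits G) = \<alpha> * real n
     \<and> (\<forall>lam>0. \<forall>\<delta>\<in>{-1, 1}.
          measure_pmf.prob (random_ordered_perfect_matching n k)
            {M. \<delta> * (hits G M - \<alpha> * real n) \<ge> 2 * lam}
          \<le> 2 * exp (- (lam\<^sup>2 / (\<alpha> * real n / 2 + 2 * lam))))
     \<and> (\<forall>mu>0. \<forall>lam. \<forall>\<delta>\<in>{-1, 1}.
          lam \<ge> 2 * sqrt (\<alpha> * real n) + 1 \<and> 2 * sqrt (\<alpha> * real n) + 1 \<ge> 9 \<longrightarrow>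
          measure_pmf.prob (random_ordered_perfect_matching n k)
            {M. \<delta> * (hits G M - \<alpha> * real n) > 2 * lam + 2 * mu}
          \<le> measure_pmf.prob (random_ordered_perfect_matching n k)
              {M. \<delta> * (hits G M - \<alpha> * real n) \<ge> 1}
            * (4 * exp (- (mu\<^sup>2 / ((\<alpha> * real n + 2 * lam) / 2 + 2 * mu)))))"
proof -
  define g where "g = (\<lambda>(j::nat) l. of_bool (tuple_of k l \<in> G) :: real)"
  have g: "g j l \<in> {0, 1}" for j l by (simp add: g_def)
  have hit_density: "hit_density n k (g j) = \<alpha>" for j
    unfolding g_def by (simp add: hit_density_indicator[OF assms(3)] assms(4))
  have \<alpha>: "0 \<le> \<alpha>" "\<alpha> \<le> 1" using hit_density_unit[of n "g 0" k] hit_density[of 0] g assms(1) by auto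
  note prob = prob_hits[OF assms(2), where n = n and G = G, folded g_def]
  have "measure_pmf.expectation (random_ordered_perfect_matching n k) (hits G) = \<alpha> * real n"
    by (simp add: expectation_hits[OF assms(2)] hit_expectation_id hit_density[unfolded g_def] mult.commute)
  moreover have "measure_pmf.prob (random_ordered_perfect_matching n k)
        {M. \<delta> * (hits G M - \<alpha> * real n) \<ge> 2 * lam}
      \<le> 2 * exp (- (lam\<^sup>2 / (\<alpha> * real n / 2 + 2 * lam)))"
    if lam: "lam > 0" and \<delta>: "\<delta> \<in> {-1, 1}" for lam \<delta>
  proof -
    have "measure_pmf.prob (random_ordered_perfect_matching n k) {M. \<delta> * (hits G M - \<alpha> * real n) \<ge> 2 * lam}
        \<le> 2 * exp (- ((2 * lam)\<^sup>2 / (2 * (\<alpha> * real n) + 4 * (2 * lam))))"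
    proof (cases "n \<ge> 3")
      case True
      have "hit_expectation n k g (\<lambda>y. of_bool (\<delta> * (y - \<alpha> * real n) \<ge> 2 * lam))
          \<le> 2 * exp (- ((2 * lam)\<^sup>2 / (2 * (\<alpha> * real n) + 4 * (2 * lam))))"
        by (rule hit_expectation_tail[OF True g hit_density \<delta>]) (use lam in simp)
      then show ?thesis by (simp only: prob[of "\<lambda>y. \<delta> * (y - \<alpha> * real n) \<ge> 2 * lam"])
    next
      case False
      then show ?thesis using prob_tail_small[OF _ \<alpha> assms(2) \<delta>, of n "2 * lam" G] lam by simp
    qed
    also have "(2 * lam)\<^sup>2 / (2 * (\<alpha> * real n) + 4 * (2 * lam)) = lam\<^sup>2 / (\<alpha> * real n / 2 + 2 * lam)"
    proof -
      have "(2 * lam)\<^sup>2 = 4 * lam\<^sup>2" "2 * (\<alpha> * real n) + 4 * (2 * lam) = 4 * (\<alpha> * real n / 2 + 2 * lam)"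
        by (simp_all add: power2_eq_square)
      then show ?thesis by (metis mult_divide_mult_cancel_left zero_neq_numeral)
    qed
    finally show ?thesis .
  qed
  moreover have "measure_pmf.prob (random_ordered_perfect_matching n k)
        {M. \<delta> * (hits G M - \<alpha> * real n) > 2 * lam + 2 * mu}
      \<le> measure_pmf.prob (random_ordered_perfect_matching n k) {M. \<delta> * (hits G M - \<alpha> * real n) \<ge> 1}
        * (4 * exp (- (mu\<^sup>2 / ((\<alpha> * real n + 2 * lam) / 2 + 2 * mu))))"
    if mu: "mu > 0" and \<delta>: "\<delta> \<in> {-1, 1}"
      and lam: "lam \<ge> 2 * sqrt (\<alpha> * real n) + 1" "2 * sqrt (\<alpha> * real n) + 1 \<ge> 9" for mu lam \<delta>
  proof -
    have m0: "0 \<le> \<alpha> * real n" using \<alpha> by simp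
    \<comment> \<open>The bound by 9 forces a mean of at least 16, hence \<open>n \<ge> 3\<close> as
      the martingale tree requires.\<close>
    have "4 \<le> sqrt (\<alpha> * real n)" using lam(2) by simp
    then have "4\<^sup>2 \<le> (sqrt (\<alpha> * real n))\<^sup>2" by (rule power_mono) simp
    then have "16 \<le> \<alpha> * real n" using m0 by simp
    also have "\<dots> \<le> real n" using \<alpha> by (simp add: mult_left_le_one_le)
    finally have n: "n \<ge> 3" by linarith
    have tree: "martingale_tree (\<alpha> * real n) (hit_expectation n k g)"
      using martingale_tree_expec[where g = g and d = k, OF n g] by (simp add: hit_density mult.commute)
    show ?thesis
      unfolding prob[of "\<lambda>y. \<delta> * (y - \<alpha> * real n) > 2 * lam + 2 * mu"] prob[of "\<lambda>y. \<delta> * (y - \<alpha> * real n) \<ge> 1"]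
      by (rule martingale_tree_tail[OF tree \<delta> m0 lam(1) _ mu]) (use lam in simp_all)
  qed
  ultimately show ?thesis by blast
qed

end
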